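(* Let $\mathcal{F}$ be a family of real $2\times 2$ matrices such that every $M=\begin{pmatrix} m_{11}&m_{12}\\ m_{21}&m_{22}\end{pmatrix}\in\mathcal{F}$ satisfies $m_{11}+m_{22}\ge m_{12}+m_{21}$. Then $\mathrm{MWDP}(\mathcal{F})$ can be solved in polynomial time.
   Context: Maximum Weighted Digraph Partition $\mathrm{MWDP}(\mathcal{F})$: an instance is a triple $(D,c,f)$ where $D$ is a digraph, $c:A(D)\to\mathbb{R}_{\ge 0}$ assigns nonnegative weights to arcs, and $f:A(D)\to\mathcal{F}$ assigns a matrix of $\mathcal{F}$ to each arc. For a partition $P=(X_1,X_2)$ of $V(D)$ and an arc $uv$ with $f(uv)=M$, define $w^P(uv)=c(uv)m_{11}$ if $u,v\in X_1$; $c(uv)m_{22}$ if $u,v\in X_2$; $c(uv)m_{12}$ if $u\in X_1,v\in X_2$; $c(uv)m_{21}$ if $u\in X_2,v\in X_1$. Let $w^P(D)=\sum_{a\in A(D)}w^P(a)$. The goal is to find a partition $P$ maximizing $w^P(D)$. *)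

theory Defs
  imports
    "HOL-Analysis.Analysis"
    "HOL-Library.Log_Nat"
    "HOL-Computational_Algebra.Polynomial"
    "Graph_Theory.Pair_Digraph"
begin

section \<open>The problem MWDP\<close>

text \<open>
  The locale \<open>pair_digraph\<close> of the graph library describes finite digraphs without loops and
  parallel arcs; an arc \<open>uv\<close> is the pair \<open>(u, v)\<close>. Vertices are natural numbers, not necessarily
  an initial segment.
\<close>

type_synonym mat2 = "real^2^2"

definition MWDP_instance ::
  "mat2 set \<Rightarrow> nat pair_pre_digraph \<Rightarrow> (nat \<times> nat \<Rightarrow> real) \<Rightarrow> (nat \<times> nat \<Rightarrow> mat2) \<Rightarrow> bool"
where
  "MWDP_instance F D c f \<longleftrightarrow>
     pair_digraph D \<and> (\<forall>a\<in>parcs D. 0 \<le> c a) \<and> (\<forall>a\<in>parcs D. f a \<in> F)"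

text \<open>A part may be empty.\<close>

definition bipartition :: "'v set \<Rightarrow> 'v set \<times> 'v set \<Rightarrow> bool" where
  "bipartition V P \<longleftrightarrow> fst P \<union> snd P = V \<and> fst P \<inter> snd P = {}"

definition arc_weight ::
  "('v \<times> 'v \<Rightarrow> real) \<Rightarrow> ('v \<times> 'v \<Rightarrow> mat2) \<Rightarrow> 'v set \<times> 'v set \<Rightarrow> 'v \<times> 'v \<Rightarrow> real"
where
  "arc_weight c f P a =
     (let X1 = fst P; X2 = snd P; u = fst a; v = snd a; M = f a in
      if u \<in> X1 \<and> v \<in> X1 then c a * M$1$1
      else if u \<in> X2 \<and> v \<in> X2 then c a * M$2$2
      else if u \<in> X1 \<and> v \<in> X2 then c a * M$1$2
      else c a * M$2$1)"

definition partition_weight ::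
  "'v pair_pre_digraph \<Rightarrow> ('v \<times> 'v \<Rightarrow> real) \<Rightarrow> ('v \<times> 'v \<Rightarrow> mat2) \<Rightarrow> 'v set \<times> 'v set \<Rightarrow> real"
where
  "partition_weight D c f P = (\<Sum>a\<in>parcs D. arc_weight c f P a)"

definition optimal_partition ::
  "'v pair_pre_digraph \<Rightarrow> ('v \<times> 'v \<Rightarrow> real) \<Rightarrow> ('v \<times> 'v \<Rightarrow> mat2) \<Rightarrow> 'v set \<times> 'v set \<Rightarrow> bool"
where
  "optimal_partition D c f P \<longleftrightarrow>
     bipartition (pverts D) P \<and>
     (\<forall>Q. bipartition (pverts D) Q \<longrightarrow> partition_weight D c f Q \<le> partition_weight D c f P)"


section \<open>Random access machines over the reals\<close>

text \<open>
  Programs work on finitely many named arrays of natural numbers and of reals, with indirect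
  addressing; a scalar is the cell 0 of an array. Naturals have no multiplication, so that unit
  cost does not give them superpolynomial power. Reals have the field operations and order tests
  only: no rounding, no conversion to naturals, and no real constants other than integers.
\<close>

datatype nexp =
    NConst nat
  | NCell string nexp
  | NAdd nexp nexp
  | NSub nexp nexp

datatype rexp =
    RConst int
  | RCell string nexp
  | RAdd rexp rexp
  | RSub rexp rexp
  | RMul rexp rexp
  | RDiv rexp rexp

datatype test =
    NLess nexp nexp
  | RLess rexp rexp
  | TNot test
  | TAnd test test

datatype prog =
    NAssign string nexp nexp
  | RAssign string nexp rexp
  | Seq prog prog
  | If test prog prog
  | While test prog

record store =
  nats :: "string \<Rightarrow> nat \<Rightarrow> nat"
  reals :: "string \<Rightarrow> nat \<Rightarrow> real"

primrec nval :: "store \<Rightarrow> nexp \<Rightarrow> nat" where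
  "nval s (NConst k) = k"
| "nval s (NCell x e) = nats s x (nval s e)"
| "nval s (NAdd e1 e2) = nval s e1 + nval s e2"
| "nval s (NSub e1 e2) = nval s e1 - nval s e2"

primrec rval :: "store \<Rightarrow> rexp \<Rightarrow> real" where
  "rval s (RConst k) = of_int k"
| "rval s (RCell x e) = reals s x (nval s e)"
| "rval s (RAdd e1 e2) = rval s e1 + rval s e2"
| "rval s (RSub e1 e2) = rval s e1 - rval s e2"
| "rval s (RMul e1 e2) = rval s e1 * rval s e2"
| "rval s (RDiv e1 e2) = rval s e1 / rval s e2"

primrec tval :: "store \<Rightarrow> test \<Rightarrow> bool" where
  "tval s (NLess e1 e2) \<longleftrightarrow> nval s e1 < nval s e2"
| "tval s (RLess e1 e2) \<longleftrightarrow> rval s e1 < rval s e2"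
| "tval s (TNot b) \<longleftrightarrow> \<not> tval s b"
| "tval s (TAnd b1 b2) \<longleftrightarrow> tval s b1 \<and> tval s b2"

text \<open>
  Running times are measured relative to two functions \<open>kn\<close> and \<open>kr\<close> giving the charge for
  handling a natural number and a real number. Every value that occurs, including addresses
  and intermediate results, is charged.
\<close>

primrec ncost :: "(nat \<Rightarrow> nat) \<Rightarrow> store \<Rightarrow> nexp \<Rightarrow> nat" where
  "ncost kn s (NConst k) = kn k"
| "ncost kn s (NCell x e) = ncost kn s e + kn (nval s (NCell x e))"
| "ncost kn s (NAdd e1 e2) = ncost kn s e1 + ncost kn s e2 + kn (nval s (NAdd e1 e2))"
| "ncost kn s (NSub e1 e2) = ncost kn s e1 + ncost kn s e2 + kn (nval s (NSub e1 e2))"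

primrec rcost :: "(nat \<Rightarrow> nat) \<Rightarrow> (real \<Rightarrow> nat) \<Rightarrow> store \<Rightarrow> rexp \<Rightarrow> nat" where
  "rcost kn kr s (RConst k) = kr (of_int k)"
| "rcost kn kr s (RCell x e) = ncost kn s e + kr (rval s (RCell x e))"
| "rcost kn kr s (RAdd e1 e2) =
     rcost kn kr s e1 + rcost kn kr s e2 + kr (rval s (RAdd e1 e2))"
| "rcost kn kr s (RSub e1 e2) =
     rcost kn kr s e1 + rcost kn kr s e2 + kr (rval s (RSub e1 e2))"
| "rcost kn kr s (RMul e1 e2) =
     rcost kn kr s e1 + rcost kn kr s e2 + kr (rval s (RMul e1 e2))"
| "rcost kn kr s (RDiv e1 e2) =
     rcost kn kr s e1 + rcost kn kr s e2 + kr (rval s (RDiv e1 e2))"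

primrec tcost :: "(nat \<Rightarrow> nat) \<Rightarrow> (real \<Rightarrow> nat) \<Rightarrow> store \<Rightarrow> test \<Rightarrow> nat" where
  "tcost kn kr s (NLess e1 e2) = ncost kn s e1 + ncost kn s e2 + 1"
| "tcost kn kr s (RLess e1 e2) = rcost kn kr s e1 + rcost kn kr s e2 + 1"
| "tcost kn kr s (TNot b) = tcost kn kr s b + 1"
| "tcost kn kr s (TAnd b1 b2) = tcost kn kr s b1 + tcost kn kr s b2 + 1"

definition nwrite :: "string \<Rightarrow> nat \<Rightarrow> nat \<Rightarrow> store \<Rightarrow> store" where
  "nwrite x i v s = s\<lparr>nats := (nats s)(x := (nats s x)(i := v))\<rparr>"

definition rwrite :: "string \<Rightarrow> nat \<Rightarrow> real \<Rightarrow> store \<Rightarrow> store" where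
  "rwrite x i v s = s\<lparr>reals := (reals s)(x := (reals s x)(i := v))\<rparr>"

text \<open>\<open>exec kn kr p s t s'\<close>: started in \<open>s\<close>, program \<open>p\<close> halts in \<open>s'\<close> at total cost \<open>t\<close>.\<close>

inductive exec ::
  "(nat \<Rightarrow> nat) \<Rightarrow> (real \<Rightarrow> nat) \<Rightarrow> prog \<Rightarrow> store \<Rightarrow> nat \<Rightarrow> store \<Rightarrow> bool"
  for kn :: "nat \<Rightarrow> nat" and kr :: "real \<Rightarrow> nat"
where
  exec_NAssign:
    "exec kn kr (NAssign x i e) s (ncost kn s i + ncost kn s e + 1)
       (nwrite x (nval s i) (nval s e) s)"
| exec_RAssign:
    "exec kn kr (RAssign x i e) s (ncost kn s i + rcost kn kr s e + 1)
       (rwrite x (nval s i) (rval s e) s)"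
| exec_Seq:
    "exec kn kr p s t s' \<Longrightarrow> exec kn kr q s' t' s'' \<Longrightarrow> exec kn kr (Seq p q) s (t + t') s''"
| exec_If_True:
    "tval s b \<Longrightarrow> exec kn kr p s t s' \<Longrightarrow>
     exec kn kr (If b p q) s (tcost kn kr s b + t) s'"
| exec_If_False:
    "\<not> tval s b \<Longrightarrow> exec kn kr q s t s' \<Longrightarrow>
     exec kn kr (If b p q) s (tcost kn kr s b + t) s'"
| exec_While_True:
    "tval s b \<Longrightarrow> exec kn kr p s t s' \<Longrightarrow> exec kn kr (While b p) s' t' s'' \<Longrightarrow>
     exec kn kr (While b p) s (tcost kn kr s b + t + t') s''"
| exec_While_False:
    "\<not> tval s b \<Longrightarrow> exec kn kr (While b p) s (tcost kn kr s b) s"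

text \<open>
  Unit charges give the real RAM. The charges \<open>nat_bits\<close> and \<open>real_bits\<close> (meant for rational
  numbers only, in lowest terms) give the logarithmic cost RAM, which is polynomially
  equivalent to the Turing machine.
\<close>

definition nat_bits :: "nat \<Rightarrow> nat" where
  "nat_bits k = floorlog 2 k + 1"

definition rat_bits :: "rat \<Rightarrow> nat" where
  "rat_bits r = floorlog 2 (nat \<bar>fst (quotient_of r)\<bar>) + floorlog 2 (nat (snd (quotient_of r))) + 1"

definition real_bits :: "real \<Rightarrow> nat" where
  "real_bits x = rat_bits (the_inv of_rat x)"


section \<open>Polynomial-time solvability of MWDP\<close>

text \<open>
  An instance is presented by enumerations \<open>vs\<close> of its vertices and \<open>as\<close> of its arcs. The
  arrays \<open>tail\<close> and \<open>head\<close> hold positions in \<open>vs\<close>. A program must work for every presentation.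
\<close>

definition presents :: "nat list \<Rightarrow> (nat \<times> nat) list \<Rightarrow> nat pair_pre_digraph \<Rightarrow> bool" where
  "presents vs as D \<longleftrightarrow>
     distinct vs \<and> set vs = pverts D \<and> distinct as \<and> set as = parcs D"

definition position :: "nat list \<Rightarrow> nat \<Rightarrow> nat" where
  "position vs v = length (takeWhile (\<lambda>u. u \<noteq> v) vs)"

definition array :: "'b::zero list \<Rightarrow> nat \<Rightarrow> 'b" where
  "array xs i = (if i < length xs then xs ! i else 0)"

definition input_store ::
  "nat list \<Rightarrow> (nat \<times> nat) list \<Rightarrow> (nat \<times> nat \<Rightarrow> real) \<Rightarrow> (nat \<times> nat \<Rightarrow> mat2) \<Rightarrow> store"
where
  "input_store vs as c f =
    \<lparr> nats = (\<lambda>_. array [])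
        (''n'' := array [length vs],
         ''m'' := array [length as],
         ''tail'' := array (map (\<lambda>a. position vs (fst a)) as),
         ''head'' := array (map (\<lambda>a. position vs (snd a)) as)),
      reals = (\<lambda>_. array [])
        (''c'' := array (map c as),
         ''m11'' := array (map (\<lambda>a. f a $1$1) as),
         ''m12'' := array (map (\<lambda>a. f a $1$2) as),
         ''m21'' := array (map (\<lambda>a. f a $2$1) as),
         ''m22'' := array (map (\<lambda>a. f a $2$2) as)) \<rparr>"

text \<open>The answer is read off the array \<open>X\<close>: entry 1 puts a vertex into the first part.\<close>

definition output_partition :: "nat list \<Rightarrow> store \<Rightarrow> nat set \<times> nat set" where
  "output_partition vs s =
     ({vs ! i |i. i < length vs \<and> nats s ''X'' i = 1},
      {vs ! i |i. i < length vs \<and> nats s ''X'' i \<noteq> 1})"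

definition input_size ::
  "(real \<Rightarrow> nat) \<Rightarrow> nat pair_pre_digraph \<Rightarrow> (nat \<times> nat \<Rightarrow> real) \<Rightarrow> (nat \<times> nat \<Rightarrow> mat2) \<Rightarrow> nat"
where
  "input_size kr D c f =
     card (pverts D) + (\<Sum>a\<in>parcs D. kr (c a) + (\<Sum>i\<in>UNIV. \<Sum>j\<in>UNIV. kr (f a $ i $ j)))"

definition solves_MWDP_within ::
  "(nat \<Rightarrow> nat) \<Rightarrow> (real \<Rightarrow> nat) \<Rightarrow> prog \<Rightarrow> nat poly \<Rightarrow>
   nat pair_pre_digraph \<Rightarrow> (nat \<times> nat \<Rightarrow> real) \<Rightarrow> (nat \<times> nat \<Rightarrow> mat2) \<Rightarrow> bool"
where
  "solves_MWDP_within kn kr p q D c f \<longleftrightarrow>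
     (\<forall>vs as. presents vs as D \<longrightarrow>
       (\<exists>t s. exec kn kr p (input_store vs as c f) t s \<and>
              t \<le> poly q (input_size kr D c f) \<and>
              optimal_partition D c f (output_partition vs s)))"

definition rational_data ::
  "nat pair_pre_digraph \<Rightarrow> (nat \<times> nat \<Rightarrow> real) \<Rightarrow> (nat \<times> nat \<Rightarrow> mat2) \<Rightarrow> bool"
where
  "rational_data D c f \<longleftrightarrow> (\<forall>a\<in>parcs D. c a \<in> \<rat> \<and> (\<forall>i j. f a $ i $ j \<in> \<rat>))"

text \<open>
  For real data, polynomial time is understood in the usual sense for numerical problems: a
  single program makes polynomially many elementary operations in the number of input numbers
  and, on rational data, runs in time polynomial in the bit length of the input.
\<close>

definition MWDP_polynomial_time :: "mat2 set \<Rightarrow> bool" where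
  "MWDP_polynomial_time F \<longleftrightarrow>
     (\<exists>p q q'. \<forall>D c f. MWDP_instance F D c f \<longrightarrow>
        solves_MWDP_within (\<lambda>_. 1) (\<lambda>_. 1) p q D c f \<and>
        (rational_data D c f \<longrightarrow> solves_MWDP_within nat_bits real_bits p q' D c f))"

end

theory Submission
  imports Defs
begin

text \<open>
  With \<open>S\<close> the first part, the weight of a partition is a constant plus
  \<open>(\<Sum>v\<in>S. e v) - cut S\<close>, where the arc \<open>uv\<close> has the capacity
  \<open>c(uv) * (m11 + m22 - m12 - m21) \<ge> 0\<close> in the cut, the vertex \<open>u\<close> receives \<open>c(uv) * (m11 - m21)\<close>
  and \<open>v\<close> receives \<open>c(uv) * (m21 - m22)\<close>. So an optimal partition is a minimum cut. Moving an
  amount of \<open>e\<close> along a residual arc, and updating the residual capacities, changes this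
  expression for no \<open>S\<close>, which makes it the invariant of a push-relabel algorithm without
  source and sink.

  In every round the levels \<open>n - 1, \<dots>, 0\<close> of the labelling are swept downwards, each vertex of
  the level pushing as much of its positive \<open>e\<close> as possible one level down; afterwards an active
  vertex (\<open>e > 0\<close>, label below \<open>n\<close>) has no admissible arc left, and all active vertices are raised
  by one level. Labels never exceed \<open>n\<close>, so no vertex is active after \<open>n * n\<close> rounds. By the
  pigeonhole principle some level \<open>g \<le> n\<close> is then empty; no residual arc crosses it downwards,
  \<open>e \<ge> 0\<close> above it and \<open>e \<le> 0\<close> below it, hence the vertices above \<open>g\<close> form an optimal \<open>S\<close>.

  All loops run over ranges known in advance. If \<open>Q\<close> is the product of all denominators of the
  input, then every real number that is ever computed is a multiple of \<open>1 / Q\<^sup>2\<close>, and it is at most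
  \<open>12 * (m + 1)\<close> times the largest input number or product of two input numbers.
\<close>

section \<open>Running programs\<close>

primrec straight :: "prog \<Rightarrow> bool" where
  "straight (NAssign x i e) \<longleftrightarrow> True"
| "straight (RAssign x i e) \<longleftrightarrow> True"
| "straight (Seq p q) \<longleftrightarrow> straight p \<and> straight q"
| "straight (If b p q) \<longleftrightarrow> straight p \<and> straight q"
| "straight (While b p) \<longleftrightarrow> False"

text \<open>\<open>exec\<close> is a relation, whereas \<open>effect\<close> and
  \<open>charge\<close> are functions that the simplifier can evaluate. Their \<open>While\<close>
  clauses are dummies: only \<open>straight\<close> programs are evaluated this way.\<close>

primrec effect :: "prog \<Rightarrow> store \<Rightarrow> store" where
  "effect (NAssign x i e) s = nwrite x (nval s i) (nval s e) s"
| "effect (RAssign x i e) s = rwrite x (nval s i) (rval s e) s"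
| "effect (Seq p q) s = effect q (effect p s)"
| "effect (If b p q) s = (if tval s b then effect p s else effect q s)"
| "effect (While b p) s = s"

primrec charge :: "(nat \<Rightarrow> nat) \<Rightarrow> (real \<Rightarrow> nat) \<Rightarrow> prog \<Rightarrow> store \<Rightarrow> nat" where
  "charge kn kr (NAssign x i e) s = ncost kn s i + ncost kn s e + 1"
| "charge kn kr (RAssign x i e) s = ncost kn s i + rcost kn kr s e + 1"
| "charge kn kr (Seq p q) s = charge kn kr p s + charge kn kr q (effect p s)"
| "charge kn kr (If b p q) s =
     tcost kn kr s b + (if tval s b then charge kn kr p s else charge kn kr q s)"
| "charge kn kr (While b p) s = 0"

lemma exec_straight:
  "straight p \<Longrightarrow> exec kn kr p s (charge kn kr p s) (effect p s)"
  by (induction p arbitrary: s) (auto intro: exec.intros exec_NAssign[simplified] exec_RAssign[simplified])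

text \<open>Total correctness with a time bound: \<open>T\<close> limits the cost and
  \<open>Q\<close> is the postcondition. As in a weakest precondition, the start store comes
  last.\<close>

definition runs ::
  "(nat \<Rightarrow> nat) \<Rightarrow> (real \<Rightarrow> nat) \<Rightarrow> prog \<Rightarrow> nat \<Rightarrow> (store \<Rightarrow> bool) \<Rightarrow> store \<Rightarrow> bool"
where
  "runs kn kr p T Q s \<longleftrightarrow> (\<exists>t s'. exec kn kr p s t s' \<and> t \<le> T \<and> Q s')"

lemma runs_straight:
  "straight p \<Longrightarrow> charge kn kr p s \<le> T \<Longrightarrow> Q (effect p s) \<Longrightarrow> runs kn kr p T Q s"
  unfolding runs_def using exec_straight by blast

lemma runs_Seq:
  assumes "runs kn kr p T R s" and "\<And>s'. R s' \<Longrightarrow> runs kn kr q T' Q s'"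
  shows "runs kn kr (Seq p q) (T + T') Q s"
  using assms unfolding runs_def by (meson add_mono exec_Seq)

lemma runs_mono:
  "runs kn kr p T R s \<Longrightarrow> T \<le> T' \<Longrightarrow> (\<And>s'. R s' \<Longrightarrow> Q s') \<Longrightarrow> runs kn kr p T' Q s"
  unfolding runs_def by (meson le_trans)

section \<open>Derived constructs and the rule for counting loops\<close>

abbreviation NVar :: "string \<Rightarrow> nexp" where "NVar x \<equiv> NCell x (NConst 0)"

text \<open>Equality, in spite of the name: neither side is less than the other.\<close>

definition NEq :: "nexp \<Rightarrow> nexp \<Rightarrow> test" where
  "NEq e1 e2 = TAnd (TNot (NLess e1 e2)) (TNot (NLess e2 e1))"

text \<open>The language has no empty statement. The write goes to an array of its own, which is why
  \<open>''skip''\<close> appears in the frame conditions below.\<close>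

definition Skip :: prog where
  "Skip = NAssign ''skip'' (NConst 0) (NConst 0)"

definition For :: "string \<Rightarrow> nexp \<Rightarrow> prog \<Rightarrow> prog" where
  "For x b p = Seq (NAssign x (NConst 0) (NConst 0))
     (While (NLess (NVar x) b) (Seq p (NAssign x (NConst 0) (NAdd (NVar x) (NConst 1)))))"

lemma nats_nwrite [simp]: "nats (nwrite x i v s) = (nats s)(x := (nats s x)(i := v))"
  and reals_nwrite [simp]: "reals (nwrite x i v s) = reals s"
  and nats_rwrite [simp]: "nats (rwrite x i r s) = nats s"
  and reals_rwrite [simp]: "reals (rwrite x i r s) = (reals s)(x := (reals s x)(i := r))"
  by (simp_all add: nwrite_def rwrite_def)

text \<open>\<open>I i\<close> holds when the counter is \<open>i\<close> and the test is due; the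
  body leaves the counter alone and establishes \<open>I (Suc i)\<close> for the store after the
  increment. An iteration costs \<open>T\<close>, at most \<open>7 * C\<close> for the test and at
  most \<open>6 * C\<close> for the increment; the extra summand in \<open>n + 1\<close> pays for
  the initialisation and the last test.\<close>

lemma runs_For:
  assumes "I 0 (nwrite x 0 0 s)"
    and counter: "\<And>i s. I i s \<Longrightarrow> nats s x 0 = i"
    and bound: "\<And>i s. I i s \<Longrightarrow> nval s b = n \<and> ncost kn s b \<le> 4 * C"
    and body: "\<And>i s. i < n \<Longrightarrow> I i s \<Longrightarrow>
      runs kn kr p T (\<lambda>s'. nats s' x 0 = i \<and> I (Suc i) (nwrite x 0 (Suc i) s')) s"
    and kn: "\<And>k. k \<le> Suc n \<Longrightarrow> kn k \<le> C" and "1 \<le> C"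
  shows "runs kn kr (For x b p) ((n + 1) * (T + 20 * C)) (I n) s"
proof -
  let ?p = "Seq p (NAssign x (NConst 0) (NAdd (NVar x) (NConst 1)))"
  let ?W = "While (NLess (NVar x) b) ?p"
  have test: "tcost kn kr s (NLess (NVar x) b) \<le> 7 * C"
    if "I i s" "i \<le> n" for i s
    using counter[OF that(1)] bound[OF that(1)] kn[of 0] kn[of i] that(2) \<open>1 \<le> C\<close> by auto
  have loop: "i \<le> n \<Longrightarrow> I i s \<Longrightarrow> runs kn kr ?W ((n - i) * (T + 20 * C) + 7 * C) (I n) s" for i s
  proof (induction "n - i" arbitrary: i s)
    case 0
    then have "\<not> tval s (NLess (NVar x) b)"
      using counter bound by (metis diff_is_0_eq' leD tval.simps(1) nval.simps(1,2) zero_less_diff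
          le_antisym less_irrefl)
    with 0 show ?case
      using test[of i s] exec_While_False[of s _ kn kr ?p] unfolding runs_def
      by (metis add_0 diff_is_0_eq diff_self_eq_0 le_antisym mult_0)
  next
    case (Suc k)
    then have "i < n" by simp
    then obtain t s' where p: "exec kn kr p s t s'" "t \<le> T" "nats s' x 0 = i"
      and I: "I (Suc i) (nwrite x 0 (Suc i) s')"
      using body Suc.prems unfolding runs_def by blast
    let ?e = "NAssign x (NConst 0) (NAdd (NVar x) (NConst 1))"
    have e: "exec kn kr ?e s' (charge kn kr ?e s') (nwrite x 0 (Suc i) s')"
      using exec_straight[of ?e kn kr s'] p(3) by simp
    have ce: "charge kn kr ?e s' \<le> 6 * C"
      using kn[of 0] kn[of 1] kn[of i] kn[of "Suc i"] p(3) \<open>i < n\<close> \<open>1 \<le> C\<close> by simp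
    obtain t' s'' where W: "exec kn kr ?W (nwrite x 0 (Suc i) s') t' s''"
      "t' \<le> (n - Suc i) * (T + 20 * C) + 7 * C" "I n s''"
      using Suc.hyps(1)[of "Suc i"] Suc.hyps(2) \<open>i < n\<close> I unfolding runs_def by fastforce
    have b: "tval s (NLess (NVar x) b)"
      using counter[OF Suc.prems(2)] bound[OF Suc.prems(2)] \<open>i < n\<close> by simp
    have "exec kn kr ?W s (tcost kn kr s (NLess (NVar x) b) + (t + charge kn kr ?e s') + t') s''"
      using exec_While_True[OF b exec_Seq[OF p(1) e] W(1)] .
    moreover have "tcost kn kr s (NLess (NVar x) b) + (t + charge kn kr ?e s') + t'
      \<le> Suc (n - Suc i) * (T + 20 * C) + 7 * C"
      using test[OF Suc.prems(2)] ce W(2) p(2) \<open>i < n\<close> by simp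
    moreover have "Suc (n - Suc i) = n - i"
      using \<open>i < n\<close> by simp
    ultimately show ?case
      using W(3) unfolding runs_def by auto
  qed
  have "runs kn kr (NAssign x (NConst 0) (NConst 0)) (3 * C) (I 0) s"
    by (rule runs_straight) (use assms(1) kn[of 0] \<open>1 \<le> C\<close> in auto)
  then have "runs kn kr (For x b p) (3 * C + (n * (T + 20 * C) + 7 * C)) (I n) s"
    unfolding For_def by (rule runs_Seq) (use loop[of 0] in simp)
  then show ?thesis
    by (rule runs_mono) simp_all
qed

section \<open>Labelled preflows\<close>

text \<open>
  \<open>r a\<close> and \<open>r' a\<close> are the residual capacities of the arc \<open>a\<close> in its own and in the opposite
  direction, \<open>d\<close> is the labelling.
\<close>

definition cut_value ::
  "nat \<Rightarrow> (nat \<Rightarrow> nat) \<Rightarrow> (nat \<Rightarrow> nat) \<Rightarrow> (nat \<Rightarrow> real) \<Rightarrow> (nat \<Rightarrow> real) \<Rightarrow> (nat \<Rightarrow> real) \<Rightarrow> nat set \<Rightarrow> real"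
where
  "cut_value m src dst e r r' S =
     (\<Sum>v\<in>S. e v) - (\<Sum>a<m. (if src a \<in> S \<and> dst a \<notin> S then r a else 0) +
                           (if dst a \<in> S \<and> src a \<notin> S then r' a else 0))"

text \<open>Reversing all arcs exchanges the two residual capacities. This symmetry turns facts
  about pushing along an arc into facts about pushing against it.\<close>

lemma cut_value_swap: "cut_value m dst src e r' r S = cut_value m src dst e r r' S"
  by (simp add: cut_value_def add.commute)

text \<open>
  Sweep \<open>k\<close> of a round handles level \<open>n - 1 - k\<close>, written without subtraction. The levels above it
  have been handled completely, this level for the arcs below \<open>i\<close>.
\<close>

definition settled ::
  "nat \<Rightarrow> nat \<Rightarrow> (nat \<Rightarrow> nat) \<Rightarrow> (nat \<Rightarrow> nat) \<Rightarrow> nat \<Rightarrow> nat \<Rightarrow> (nat \<Rightarrow> nat) \<Rightarrow> (nat \<Rightarrow> real) \<Rightarrow> (nat \<Rightarrow> real) \<Rightarrow> bool"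
where
  "settled n m src dst k i d e r \<longleftrightarrow>
     (\<forall>b<m. d (src b) = Suc (d (dst b)) \<and> d (src b) < n \<and>
        (n \<le> d (src b) + k \<or> n = Suc (d (src b) + k) \<and> b < i) \<longrightarrow> e (src b) \<le> 0 \<or> r b = 0)"

text \<open>An arc that does not descend from the current level imposes no condition, so the arc
  bound moves past it.\<close>

lemma settled_skip:
  assumes "settled n m src dst k a d e r"
    and "\<not> (Suc (d (src a) + k) = n \<and> d (src a) = Suc (d (dst a)))"
  shows "settled n m src dst k (Suc a) d e r"
  unfolding settled_def
proof (intro allI impI; elim conjE)
  fix b assume b: "b < m" "d (src b) = Suc (d (dst b))" "d (src b) < n"
    and *: "n \<le> d (src b) + k \<or> n = Suc (d (src b) + k) \<and> b < Suc a"
  have "n \<le> d (src b) + k \<or> n = Suc (d (src b) + k) \<and> b < a"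
  proof (cases "b = a")
    case True
    then show ?thesis using * assms(2) b(2) by metis
  next
    case False
    then show ?thesis using * by (metis less_SucE)
  qed
  then show "e (src b) \<le> 0 \<or> r b = 0"
    using assms(1) b unfolding settled_def by blast
qed

text \<open>With all \<open>m\<close> arcs handled, the current level joins the completed
  ones.\<close>

lemma settled_next:
  assumes "settled n m src dst k m d e r"
  shows "settled n m src dst (Suc k) 0 d e r"
  unfolding settled_def
proof (intro allI impI; elim conjE)
  fix b assume b: "b < m" "d (src b) = Suc (d (dst b))" "d (src b) < n"
    and "n \<le> d (src b) + Suc k \<or> n = Suc (d (src b) + Suc k) \<and> b < 0"
  then have "n \<le> d (src b) + k \<or> n = Suc (d (src b) + k) \<and> b < m"
    by linarith
  then show "e (src b) \<le> 0 \<or> r b = 0"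
    using assms b unfolding settled_def by blast
qed

definition idle :: "nat \<Rightarrow> (nat \<Rightarrow> nat) \<Rightarrow> (nat \<Rightarrow> real) \<Rightarrow> bool" where
  "idle n d e \<longleftrightarrow> (\<forall>v<n. d v = n \<or> e v \<le> 0)"

definition relabel :: "nat \<Rightarrow> (nat \<Rightarrow> nat) \<Rightarrow> (nat \<Rightarrow> real) \<Rightarrow> nat \<Rightarrow> nat" where
  "relabel n d e v = (if v < n \<and> 0 < e v \<and> d v < n then Suc (d v) else d v)"

text \<open>\<open>q a\<close> is the total residual capacity of \<open>a\<close> in both
  directions, \<open>W\<close> the function of vertex sets that every preflow represents, and
  \<open>L\<close> an additive group that no computed number leaves. Closure under sums and
  differences is enough, since pushes form no products.\<close>

locale network =
  fixes n m :: nat and src dst :: "nat \<Rightarrow> nat" and q :: "nat \<Rightarrow> real"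
    and W :: "nat set \<Rightarrow> real" and L :: "real set"
  assumes arc: "a < m \<Longrightarrow> src a < n \<and> dst a < n \<and> src a \<noteq> dst a"
    and q_nonneg: "a < m \<Longrightarrow> 0 \<le> q a"
    and L0: "0 \<in> L"
    and L_add: "x \<in> L \<Longrightarrow> y \<in> L \<Longrightarrow> x + y \<in> L"
    and L_diff: "x \<in> L \<Longrightarrow> y \<in> L \<Longrightarrow> x - y \<in> L"
begin

lemma network_swap: "network n m dst src q L"
  by unfold_locales (metis arc, metis q_nonneg, rule L0, metis L_add, metis L_diff)

text \<open>Negative \<open>e\<close> is allowed at label 0 only, so the vertices there act as
  sinks. The fourth conjunct is the usual validity of a labelling: a residual arc descends at most
  one level.\<close>

definition preflow ::
  "(nat \<Rightarrow> nat) \<Rightarrow> (nat \<Rightarrow> real) \<Rightarrow> (nat \<Rightarrow> real) \<Rightarrow> (nat \<Rightarrow> real) \<Rightarrow> bool"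
where
  "preflow d e r r' \<longleftrightarrow>
     (\<forall>S. S \<subseteq> {..<n} \<longrightarrow> cut_value m src dst e r r' S = W S) \<and>
     (\<forall>a<m. 0 \<le> r a \<and> 0 \<le> r' a \<and> r a + r' a = q a) \<and>
     (\<forall>v<n. d v \<le> n \<and> (0 < d v \<longrightarrow> 0 \<le> e v)) \<and>
     (\<forall>a<m. (0 < r a \<longrightarrow> d (src a) \<le> Suc (d (dst a))) \<and>
            (0 < r' a \<longrightarrow> d (dst a) \<le> Suc (d (src a)))) \<and>
     (\<forall>v<n. e v \<in> L) \<and> (\<forall>a<m. r a \<in> L \<and> r' a \<in> L)"

definition cleared ::
  "nat \<Rightarrow> nat \<Rightarrow> (nat \<Rightarrow> nat) \<Rightarrow> (nat \<Rightarrow> real) \<Rightarrow> (nat \<Rightarrow> real) \<Rightarrow> (nat \<Rightarrow> real) \<Rightarrow> bool"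
where
  "cleared k i d e r r' \<longleftrightarrow> settled n m src dst k i d e r \<and> settled n m dst src k i d e r'"

section \<open>Pushes along admissible arcs\<close>

lemma preflow_swap: "network.preflow n m dst src q W L d e r' r \<longleftrightarrow> preflow d e r r'"
  unfolding network.preflow_def[OF network_swap] preflow_def
  by (auto simp: cut_value_swap add.commute)

lemma cleared_swap: "network.cleared n m dst src k i d e r' r \<longleftrightarrow> cleared k i d e r r'"
  unfolding network.cleared_def[OF network_swap] cleared_def by auto

text \<open>The sum of \<open>e\<close> and the cut change by the same amount, namely
  \<open>t\<close> if \<open>dst a\<close> is in \<open>S\<close>, minus \<open>t\<close> if
  \<open>src a\<close> is in \<open>S\<close>.\<close>

lemma cut_value_push:
  assumes "a < m" "S \<subseteq> {..<n}"
  shows "cut_value m src dst (e(src a := e (src a) - t, dst a := e (dst a) + t))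
           (r(a := r a - t)) (r'(a := r' a + t)) S = cut_value m src dst e r r' S"
proof -
  have "finite S"
    using assms(2) finite_subset by blast
  have "(\<Sum>v\<in>S. (e(src a := e (src a) - t, dst a := e (dst a) + t)) v)
      = (\<Sum>v\<in>S. e v + ((if v = dst a then t else 0) - (if v = src a then t else 0)))"
    using arc[OF assms(1)] by (intro sum.cong) auto
  also have "\<dots> = (\<Sum>v\<in>S. e v) + ((if dst a \<in> S then t else 0) - (if src a \<in> S then t else 0))"
    using \<open>finite S\<close> by (simp add: sum.distrib sum_subtractf sum.delta)
  finally have E: "(\<Sum>v\<in>S. (e(src a := e (src a) - t, dst a := e (dst a) + t)) v) = \<dots>" .
  have "(\<Sum>b<m. (if src b \<in> S \<and> dst b \<notin> S then (r(a := r a - t)) b else 0) +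
                 (if dst b \<in> S \<and> src b \<notin> S then (r'(a := r' a + t)) b else 0))
     = (\<Sum>b<m. ((if src b \<in> S \<and> dst b \<notin> S then r b else 0) +
                 (if dst b \<in> S \<and> src b \<notin> S then r' b else 0)) +
          (if b = a then (if dst a \<in> S then t else 0) - (if src a \<in> S then t else 0) else 0))"
    by (intro sum.cong) auto
  also have "\<dots> = (\<Sum>b<m. (if src b \<in> S \<and> dst b \<notin> S then r b else 0) +
                 (if dst b \<in> S \<and> src b \<notin> S then r' b else 0)) +
          ((if dst a \<in> S then t else 0) - (if src a \<in> S then t else 0))"
    using assms(1) by (simp add: sum.distrib)
  finally show ?thesis
    unfolding cut_value_def using E by simp
qed

text \<open>The residual capacity that grows leads one level up, so the labelling stays valid.
  \<open>e\<close> grows only at \<open>dst a\<close>, below the level being swept, so settled arcs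
  stay settled. Taking the minimum either drains \<open>src a\<close> or saturates
  \<open>a\<close>.\<close>

lemma push:
  assumes a: "a < m" and pf: "preflow d e r r'" and cl: "cleared k a d e r r'"
    and top: "Suc (d (src a) + k) = n" and adm: "d (src a) = Suc (d (dst a))"
    and t: "t = min (e (src a)) (r a)"
  defines "e1 \<equiv> e(src a := e (src a) - t, dst a := e (dst a) + t)"
    and "r1 \<equiv> r(a := r a - t)" and "r1' \<equiv> r'(a := r' a + t)"
  shows "preflow d e1 r1 r1'" and "cleared k (Suc a) d e1 r1 r1'"
    and "idle n d e \<Longrightarrow> idle n d e1"
proof -
  note ar = arc[OF a]
  have es: "0 \<le> e (src a)" and ra: "0 \<le> r a"
    using pf ar a adm unfolding preflow_def by auto
  then have t0: "0 \<le> t" and te: "t \<le> e (src a)" and tr: "t \<le> r a"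
    unfolding t by auto
  have tL: "t \<in> L"
    using pf ar a unfolding preflow_def t min_def by auto
  show "preflow d e1 r1 r1'"
    unfolding preflow_def
  proof (intro conjI allI impI)
    fix S assume "S \<subseteq> {..<n}"
    then show "cut_value m src dst e1 r1 r1' S = W S"
      using cut_value_push[OF a] pf unfolding e1_def r1_def r1'_def preflow_def by simp
  next
    fix b assume b: "b < m"
    have old: "0 \<le> r b" "0 \<le> r' b" "r b + r' b = q b" "r b \<in> L" "r' b \<in> L"
      using pf b unfolding preflow_def by auto
    show "0 \<le> r1 b" "0 \<le> r1' b" "r1 b + r1' b = q b"
      using old t0 tr unfolding r1_def r1'_def by auto
    show "r1 b \<in> L" "r1' b \<in> L"
      using old tL L_add L_diff unfolding r1_def r1'_def by auto
    show "d (src b) \<le> Suc (d (dst b))" if "0 < r1 b"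
      using that pf b adm unfolding r1_def preflow_def by (auto split: if_splits)
    show "d (dst b) \<le> Suc (d (src b))" if "0 < r1' b"
      using that pf b adm unfolding r1'_def preflow_def by (auto split: if_splits)
  next
    fix v assume v: "v < n"
    then show "d v \<le> n" using pf unfolding preflow_def by auto
    show "0 \<le> e1 v" if "0 < d v"
      using that v pf t0 te unfolding e1_def preflow_def by auto
    show "e1 v \<in> L"
      using v ar pf tL L_add L_diff unfolding e1_def preflow_def by auto
  qed
  have le: "e1 v \<le> e v" if "d (src a) \<le> d v" for v
  proof -
    have "v \<noteq> dst a" using that adm by auto
    then show ?thesis using t0 unfolding e1_def by simp
  qed
  have drained: "e1 (src a) \<le> 0 \<or> r1 a = 0"
    unfolding e1_def r1_def t using ar by (cases "e (src a) \<le> r a") simp_all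
  show "cleared k (Suc a) d e1 r1 r1'"
    unfolding cleared_def settled_def
  proof (intro conjI allI impI; elim conjE)
    fix b assume b: "b < m" "d (src b) = Suc (d (dst b))" "d (src b) < n"
      "n \<le> d (src b) + k \<or> n = Suc (d (src b) + k) \<and> b < Suc a"
    show "e1 (src b) \<le> 0 \<or> r1 b = 0"
    proof (cases "b = a")
      case False
      then have "e (src b) \<le> 0 \<or> r b = 0"
        using cl b unfolding cleared_def settled_def less_Suc_eq by blast
      moreover have "d (src a) \<le> d (src b)"
        using b(4) top by (elim disjE conjE) linarith+
      ultimately show ?thesis
        using le[of "src b"] False unfolding r1_def by simp linarith
    qed (use drained in simp)
  next
    fix b assume b: "b < m" "d (dst b) = Suc (d (src b))" "d (dst b) < n"
      "n \<le> d (dst b) + k \<or> n = Suc (d (dst b) + k) \<and> b < Suc a"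
    \<comment> \<open>Against its direction \<open>a\<close> leads uphill, so the one entry of
      \<open>r'\<close> that is changed is not subject to this condition.\<close>
    have "b \<noteq> a"
    proof
      assume "b = a"
      then have "d (dst a) = Suc (d (src a))" using b(2) by (simp only:)
      with adm show False by linarith
    qed
    then have "e (dst b) \<le> 0 \<or> r' b = 0"
      using cl b unfolding cleared_def settled_def less_Suc_eq by blast
    moreover have "d (src a) \<le> d (dst b)"
      using b(4) top by (elim disjE conjE) linarith+
    ultimately show "e1 (dst b) \<le> 0 \<or> r1' b = 0"
      using le[of "dst b"] \<open>b \<noteq> a\<close> unfolding r1'_def by simp linarith
  qed
  show "idle n d e1" if "idle n d e"
  proof -
    \<comment> \<open>\<open>top\<close> puts \<open>src a\<close> below level \<open>n\<close>, so
      in an idle state there is nothing to push and \<open>t\<close> is 0.\<close>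
    have "e (src a) \<le> 0"
      using that ar top unfolding idle_def by force
    then have "t = 0" using es ra t by simp
    then show ?thesis using that unfolding e1_def idle_def by simp
  qed
qed

text \<open>This is \<open>push\<close> in the network with all arcs reversed.\<close>

lemma push_back:
  assumes a: "a < m" and pf: "preflow d e r r'" and cl: "cleared k a d e r r'"
    and top: "Suc (d (dst a) + k) = n" and adm: "d (dst a) = Suc (d (src a))"
    and t: "t = min (e (dst a)) (r' a)"
  defines "e1 \<equiv> e(dst a := e (dst a) - t, src a := e (src a) + t)"
    and "r1 \<equiv> r(a := r a + t)" and "r1' \<equiv> r'(a := r' a - t)"
  shows "preflow d e1 r1 r1'" and "cleared k (Suc a) d e1 r1 r1'"
    and "idle n d e \<Longrightarrow> idle n d e1"
proof -
  have pf': "network.preflow n m dst src q W L d e r' r"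
    using pf by (simp only: preflow_swap)
  have cl': "network.cleared n m dst src k a d e r' r"
    using cl by (simp only: cleared_swap)
  note push = network.push[OF network_swap a pf' cl' top adm t]
  show "preflow d e1 r1 r1'"
    using push(1) by (simp only: preflow_swap e1_def r1_def r1'_def)
  show "cleared k (Suc a) d e1 r1 r1'"
    using push(2) by (simp only: cleared_swap e1_def r1_def r1'_def)
  show "idle n d e \<Longrightarrow> idle n d e1"
    using push(3) by (simp only: e1_def)
qed

section \<open>Sweeping the levels and relabelling\<close>

lemma cleared_skip:
  assumes "cleared k a d e r r'"
    and "\<not> (Suc (d (src a) + k) = n \<and> d (src a) = Suc (d (dst a)))"
    and "\<not> (Suc (d (dst a) + k) = n \<and> d (dst a) = Suc (d (src a)))"
  shows "cleared k (Suc a) d e r r'"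
  using assms settled_skip unfolding cleared_def by metis

lemma cleared_next: "cleared k m d e r r' \<Longrightarrow> cleared (Suc k) 0 d e r r'"
  unfolding cleared_def by (metis settled_next)

text \<open>Vacuous: no level below \<open>n\<close> has been handled yet.\<close>

lemma cleared_start: "cleared 0 0 d e r r'"
  unfolding cleared_def settled_def by auto

text \<open>After \<open>n\<close> sweeps all levels below \<open>n\<close> are settled, so a
  residual arc leaving an active vertex does not descend. Raising its tail by one is then harmless,
  and raising its head at the same time only helps.\<close>

lemma preflow_relabel:
  assumes pf: "preflow d e r r'" and cl: "cleared n 0 d e r r'"
  shows "preflow (relabel n d e) e r r'"
  unfolding preflow_def
proof (intro conjI allI impI)
  fix a assume a: "a < m"
  have "e (src a) \<le> 0 \<or> r a = 0" if "d (src a) = Suc (d (dst a))" "d (src a) < n"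
    using cl a that unfolding cleared_def settled_def by auto
  moreover have "d (src a) \<le> Suc (d (dst a))" if "0 < r a"
    using pf a that unfolding preflow_def by auto
  ultimately show "relabel n d e (src a) \<le> Suc (relabel n d e (dst a))" if "0 < r a"
    using that arc[OF a] unfolding relabel_def by fastforce
  have "e (dst a) \<le> 0 \<or> r' a = 0" if "d (dst a) = Suc (d (src a))" "d (dst a) < n"
    using cl a that unfolding cleared_def settled_def by auto
  moreover have "d (dst a) \<le> Suc (d (src a))" if "0 < r' a"
    using pf a that unfolding preflow_def by auto
  ultimately show "relabel n d e (dst a) \<le> Suc (relabel n d e (src a))" if "0 < r' a"
    using that arc[OF a] unfolding relabel_def by fastforce
next
  fix v assume "v < n"
  then have "d v \<le> n \<and> (0 < d v \<longrightarrow> 0 \<le> e v)" using pf unfolding preflow_def by blast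
  then show "relabel n d e v \<le> n" and "0 < relabel n d e v \<Longrightarrow> 0 \<le> e v"
    unfolding relabel_def by (simp_all split: if_splits)
qed (use pf[unfolded preflow_def] in blast)+

section \<open>Termination of the rounds and optimality above a gap\<close>

lemma idle_relabel: "idle n d e \<Longrightarrow> idle n (relabel n d e) e"
  by (auto simp: idle_def relabel_def)

text \<open>The sum of the labels is the measure of progress: at least one active vertex is raised
  and no label falls.\<close>

lemma sum_relabel:
  assumes "\<not> idle n d e" "preflow d e r r'"
  shows "(\<Sum>v<n. d v) < (\<Sum>v<n. relabel n d e v)"
proof (rule sum_strict_mono_ex1)
  show "\<exists>v\<in>{..<n}. d v < relabel n d e v"
  proof -
    obtain v where v: "v < n" "d v \<noteq> n" "0 < e v"
      using assms(1) unfolding idle_def by force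
    moreover have "d v \<le> n"
      using v(1) assms(2) unfolding preflow_def by blast
    ultimately show ?thesis
      by (intro bexI[of _ v]) (auto simp: relabel_def)
  qed
qed (auto simp: relabel_def)

text \<open>Labels are at most \<open>n\<close>, so a sum of \<open>n * n\<close> forces every label
  to equal \<open>n\<close>.\<close>

lemma idle_of_sum:
  assumes "n * n \<le> (\<Sum>v<n. d v)" "preflow d e r r'"
  shows "idle n d e"
proof -
  have le: "\<And>v. v < n \<Longrightarrow> d v \<le> n" using assms(2) unfolding preflow_def by auto
  have "d v = n" if "v < n" for v
  proof (rule ccontr)
    assume "d v \<noteq> n"
    have "(\<Sum>v<n. d v) < (\<Sum>v<n. n)"
    proof (rule sum_strict_mono_ex1)
      show "\<exists>v\<in>{..<n}. d v < n"
        using le[OF that] \<open>d v \<noteq> n\<close> that by (intro bexI[of _ v]) simp_all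
    qed (use le in auto)
    then show False using assms(1) by simp
  qed
  then show ?thesis unfolding idle_def by simp
qed

text \<open>For the set above the gap the cut part of \<open>cut_value\<close> vanishes; for any
  other set it can only lower the value. It then suffices to compare the sums of
  \<open>e\<close>.\<close>

lemma optimal_above_gap:
  assumes pf: "preflow d e r r'" and idle: "idle n d e"
    and gap: "g \<le> n" "\<And>v. v < n \<Longrightarrow> d v \<noteq> g" and T: "T \<subseteq> {..<n}"
  shows "W T \<le> W {v. v < n \<and> g < d v}" (is "_ \<le> W ?S")
proof -
  have S: "?S \<subseteq> {..<n}" by auto
  \<comment> \<open>Such a residual arc would start above \<open>g\<close> and, level
    \<open>g\<close> being empty, end below it: a drop of at least two levels, which a valid
    labelling excludes.\<close>
  have out: "\<not> 0 < r a" if "a < m" "g < d (src a)" "\<not> g < d (dst a)" for a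
    using pf that gap(2)[of "dst a"] arc[OF that(1)] unfolding preflow_def by fastforce
  have out': "\<not> 0 < r' a" if "a < m" "g < d (dst a)" "\<not> g < d (src a)" for a
    using pf that gap(2)[of "src a"] arc[OF that(1)] unfolding preflow_def by fastforce
  have pos: "0 \<le> r a" "0 \<le> r' a" if "a < m" for a
    using pf that unfolding preflow_def by auto
  have zero: "(\<Sum>a<m. (if src a \<in> ?S \<and> dst a \<notin> ?S then r a else 0) +
                (if dst a \<in> ?S \<and> src a \<notin> ?S then r' a else 0)) = 0"
    using out out' pos arc by (intro sum.neutral ballI) (smt (verit) mem_Collect_eq lessThan_iff)
  have "W ?S = cut_value m src dst e r r' ?S"
    using pf S unfolding preflow_def by simp
  then have WS: "W ?S = (\<Sum>v\<in>?S. e v)"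
    unfolding cut_value_def zero by simp
  have "W T = cut_value m src dst e r r' T" using pf T unfolding preflow_def by simp
  moreover have "0 \<le> (\<Sum>a<m. (if src a \<in> T \<and> dst a \<notin> T then r a else 0) +
                           (if dst a \<in> T \<and> src a \<notin> T then r' a else 0))"
    by (intro sum_nonneg add_nonneg_nonneg) (simp_all add: pos)
  ultimately have 1: "W T \<le> (\<Sum>v\<in>T. e v)"
    unfolding cut_value_def by linarith
  have 2: "(\<Sum>v\<in>T. e v) \<le> (\<Sum>v\<in>T. if v \<in> ?S then e v else 0)"
  proof (rule sum_mono)
    fix v assume "v \<in> T"
    then have v: "v < n" using T by auto
    \<comment> \<open>A vertex not above the gap is strictly below it, so its label is not
      \<open>n\<close> and idleness applies.\<close>
    have "e v \<le> 0" if "\<not> g < d v"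
    proof -
      have "d v \<noteq> n" using that gap(1) gap(2)[OF v] by linarith
      then show ?thesis using idle v unfolding idle_def by blast
    qed
    then show "e v \<le> (if v \<in> ?S then e v else 0)" using v by simp
  qed
  \<comment> \<open>Vertices above the gap have a positive label and hence nonnegative
    \<open>e\<close>, so adding them loses nothing.\<close>
  have 3: "(\<Sum>v\<in>T. if v \<in> ?S then e v else 0) \<le> (\<Sum>v<n. if v \<in> ?S then e v else 0)"
  proof (rule sum_mono2)
    fix v assume "v \<in> {..<n} - T"
    then show "0 \<le> (if v \<in> ?S then e v else 0)"
      using pf unfolding preflow_def by simp
  qed (use T in auto)
  have 4: "(\<Sum>v<n. if v \<in> ?S then e v else 0) = (\<Sum>v\<in>?S. e v)"
    using S by (subst sum.inter_restrict[symmetric]) (auto simp: Int_absorb1)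
  show ?thesis using 1 2 3 4 WS by simp
qed

text \<open>These bounds do not depend on the number of pushes: the invariant \<open>W {v}\<close>
  determines \<open>e v\<close> up to the residual capacities at \<open>v\<close>.\<close>

lemma preflow_bound:
  assumes pf: "preflow d e r r'"
  shows "a < m \<Longrightarrow> \<bar>r a\<bar> \<le> (\<Sum>a<m. q a)" and "a < m \<Longrightarrow> \<bar>r' a\<bar> \<le> (\<Sum>a<m. q a)"
    and "v < n \<Longrightarrow> \<bar>e v\<bar> \<le> \<bar>W {v}\<bar> + (\<Sum>a<m. q a)"
proof -
  have old: "0 \<le> r a" "0 \<le> r' a" "r a + r' a = q a" if "a < m" for a
    using pf that unfolding preflow_def by auto
  have le: "q a \<le> (\<Sum>a<m. q a)" if "a < m" for a
    using that q_nonneg by (intro member_le_sum) auto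
  show "a < m \<Longrightarrow> \<bar>r a\<bar> \<le> (\<Sum>a<m. q a)" "a < m \<Longrightarrow> \<bar>r' a\<bar> \<le> (\<Sum>a<m. q a)"
    using old[of a] le[of a] by auto
  assume "v < n"
  then have "cut_value m src dst e r r' {v} = W {v}"
    using pf unfolding preflow_def by simp
  then have "e v = W {v} + (\<Sum>a<m. (if src a \<in> {v} \<and> dst a \<notin> {v} then r a else 0) +
                           (if dst a \<in> {v} \<and> src a \<notin> {v} then r' a else 0))" (is "_ = _ + ?X")
    unfolding cut_value_def by simp
  moreover have "?X \<le> (\<Sum>a<m. q a)"
    using old by (intro sum_mono) fastforce
  moreover have "0 \<le> ?X"
    using old by (intro sum_nonneg) auto
  ultimately show "\<bar>e v\<bar> \<le> \<bar>W {v}\<bar> + (\<Sum>a<m. q a)" by linarith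
qed

end

text \<open>Pigeonhole: \<open>n\<close> vertices cannot occupy \<open>n + 1\<close> levels.\<close>

lemma exists_gap:
  fixes d :: "nat \<Rightarrow> nat"
  shows "\<exists>g\<le>n. \<forall>v<n. d v \<noteq> g"
proof (rule ccontr)
  assume "\<not> ?thesis"
  then have "{..n} \<subseteq> d ` {..<n}" by force
  then have "card {..n} \<le> card (d ` {..<n})" by (intro card_mono) auto
  also have "\<dots> \<le> n" using card_image_le[of "{..<n}" d] by simp
  finally show False by simp
qed

section \<open>The push-relabel program\<close>

text \<open>The arrays are parameters so that the same code pushes along an arc and against it. The
  minimum is stored first, because later assignments overwrite the cells it comes from.\<close>

definition Push :: "string \<Rightarrow> string \<Rightarrow> string \<Rightarrow> string \<Rightarrow> prog" where
  "Push z z' x y =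
    (let a = NVar ''a''; u = NCell z a; v = NCell z' a; t = RCell ''t'' (NConst 0) in
     Seq (If (RLess (RCell ''e'' u) (RCell x a))
            (RAssign ''t'' (NConst 0) (RCell ''e'' u))
            (RAssign ''t'' (NConst 0) (RCell x a)))
    (Seq (RAssign x a (RSub (RCell x a) t))
    (Seq (RAssign y a (RAdd (RCell y a) t))
    (Seq (RAssign ''e'' u (RSub (RCell ''e'' u) t))
         (RAssign ''e'' v (RAdd (RCell ''e'' v) t))))))"

text \<open>As in \<open>settled\<close>, level \<open>n - 1 - k\<close> is expressed by
  \<open>d u + (k + 1) = n\<close>.\<close>

definition Admissible :: "string \<Rightarrow> string \<Rightarrow> test" where
  "Admissible z z' =
    (let a = NVar ''a''; u = NCell ''d'' (NCell z a); v = NCell ''d'' (NCell z' a) in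
     TAnd (NEq (NAdd u (NAdd (NVar ''k'') (NConst 1))) (NVar ''n''))
          (NEq u (NAdd v (NConst 1))))"

definition Step :: prog where
  "Step = If (Admissible ''tail'' ''head'') (Push ''tail'' ''head'' ''r'' ''rr'')
         (If (Admissible ''head'' ''tail'') (Push ''head'' ''tail'' ''rr'' ''r'') Skip)"

definition Pass :: prog where
  "Pass = For ''k'' (NVar ''n'') (For ''a'' (NVar ''m'') Step)"

definition Relabel :: prog where
  "Relabel = For ''v'' (NVar ''n'')
     (If (TAnd (RLess (RConst 0) (RCell ''e'' (NVar ''v'')))
               (NLess (NCell ''d'' (NVar ''v'')) (NVar ''n'')))
        (NAssign ''d'' (NVar ''v'') (NAdd (NCell ''d'' (NVar ''v'')) (NConst 1))) Skip)"

text \<open>Two nested loops provide \<open>n * n\<close> rounds, since the machine cannot multiply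
  naturals.\<close>

definition Rounds :: prog where
  "Rounds = For ''i'' (NVar ''n'') (For ''j'' (NVar ''n'') (Seq Pass Relabel))"

definition Mark :: prog where
  "Mark = For ''v'' (NVar ''n'') (NAssign ''mark'' (NCell ''d'' (NVar ''v'')) (NConst 1))"

text \<open>Levels 0 to \<open>n\<close> are inspected without early exit, so \<open>g\<close> ends
  as the highest empty level.\<close>

definition Gap :: prog where
  "Gap = For ''k'' (NAdd (NVar ''n'') (NConst 1))
     (If (NLess (NCell ''mark'' (NVar ''k'')) (NConst 1))
        (NAssign ''g'' (NConst 0) (NVar ''k'')) Skip)"

definition Select :: prog where
  "Select = For ''v'' (NVar ''n'')
     (If (NLess (NVar ''g'') (NCell ''d'' (NVar ''v'')))
        (NAssign ''X'' (NVar ''v'') (NConst 1)) Skip)"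

text \<open>\<open>rr\<close> is not written: it is zero in the input store, as nothing has been
  pushed yet.\<close>

definition Init :: prog where
  "Init = For ''a'' (NVar ''m'')
    (let a = NVar ''a''; u = NCell ''tail'' a; v = NCell ''head'' a;
         w = (\<lambda>x. RMul (RCell ''c'' a) (RCell x a)) in
     Seq (RAssign ''r'' a
           (RSub (RSub (RAdd (w ''m11'') (w ''m22'')) (w ''m12'')) (w ''m21'')))
    (Seq (RAssign ''e'' u (RAdd (RCell ''e'' u) (RSub (w ''m11'') (w ''m21''))))
         (RAssign ''e'' v (RAdd (RCell ''e'' v) (RSub (w ''m21'') (w ''m22''))))))"

definition Solver :: prog where
  "Solver = Seq Init (Seq Rounds (Seq Mark (Seq Gap Select)))"

text \<open>A frame condition for the arrays of naturals only; the reals are described explicitly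
  where they matter.\<close>

definition same_off :: "string set \<Rightarrow> store \<Rightarrow> store \<Rightarrow> bool" where
  "same_off Y s s' \<longleftrightarrow> (\<forall>x. x \<notin> Y \<longrightarrow> nats s' x = nats s x)"

lemma same_off_trans:
  "same_off Y s s' \<Longrightarrow> same_off Y' s' s'' \<Longrightarrow> Y \<union> Y' \<subseteq> Z \<Longrightarrow> same_off Z s s''"
  unfolding same_off_def by (metis UnCI subsetD)

lemma same_off_nats: "same_off Y s s' \<Longrightarrow> x \<notin> Y \<Longrightarrow> nats s' x = nats s x"
  unfolding same_off_def by blast

lemma same_off_nwrite: "same_off Y s s' \<Longrightarrow> x \<in> Y \<Longrightarrow> same_off Y s (nwrite x i v s')"
  unfolding same_off_def by auto

lemma same_off_refl: "same_off Y s s"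
  unfolding same_off_def by auto

section \<open>Effect and cost of one push\<close>

lemma NEq_val [simp]: "tval s (NEq e1 e2) \<longleftrightarrow> nval s e1 = nval s e2"
  by (auto simp: NEq_def)

lemma straight_Push [simp]: "straight (Push z z' x y)"
  by (simp add: Push_def Let_def)

text \<open>Distinct names and \<open>u \<noteq> v\<close> exclude aliasing: each cell of
  \<open>e\<close>, \<open>x\<close> and \<open>y\<close> still has its original value when it is
  read.\<close>

lemma effect_Push:
  assumes xy: "x \<noteq> ''e''" "x \<noteq> ''t''" "y \<noteq> ''e''" "y \<noteq> ''t''" "x \<noteq> y"
    and a: "nats s ''a'' 0 = a" and u: "nats s z a = u" and v: "nats s z' a = v" and "u \<noteq> v"
    and t: "t = min (reals s ''e'' u) (reals s x a)"
  shows "nats (effect (Push z z' x y) s) = nats s"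
    and "reals (effect (Push z z' x y) s) ''e'' =
           (reals s ''e'')(u := reals s ''e'' u - t, v := reals s ''e'' v + t)"
    and "reals (effect (Push z z' x y) s) x = (reals s x)(a := reals s x a - t)"
    and "reals (effect (Push z z' x y) s) y = (reals s y)(a := reals s y a + t)"
  using xy \<open>u \<noteq> v\<close> by (simp_all add: Push_def Let_def t min_def a u v)

lemma charge_Push:
  assumes xy: "x \<noteq> ''e''" "x \<noteq> ''t''" "y \<noteq> ''e''" "y \<noteq> ''t''" "x \<noteq> y"
    and a: "nats s ''a'' 0 = a" and u: "nats s z a = u" and v: "nats s z' a = v" and "u \<noteq> v"
    and t: "t = min (reals s ''e'' u) (reals s x a)"
    and kn: "kn 0 \<le> C" "kn a \<le> C" "kn u \<le> C" "kn v \<le> C" "1 \<le> C"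
    and kr: "kr (reals s ''e'' u) \<le> C" "kr (reals s x a) \<le> C" "kr (reals s ''e'' v) \<le> C"
    "kr (reals s y a) \<le> C" "kr (reals s ''e'' u - t) \<le> C" "kr (reals s ''e'' v + t) \<le> C"
    "kr (reals s x a - t) \<le> C" "kr (reals s y a + t) \<le> C"
  shows "charge kn kr (Push z z' x y) s \<le> 60 * C"
proof (cases "reals s ''e'' u < reals s x a")
  case True
  then have t: "t = reals s ''e'' u" by (simp add: t)
  from kr kn show ?thesis
    using True xy \<open>u \<noteq> v\<close> unfolding t by (simp add: Push_def Let_def a u v)
next
  case False
  then have t: "t = reals s x a" by (simp add: t)
  from kr kn show ?thesis
    using False xy \<open>u \<noteq> v\<close> unfolding t by (simp add: Push_def Let_def a u v)
qed

section \<open>Correctness and running time\<close>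

lemma same_off_step:
  "same_off Y s s' \<Longrightarrow> same_off Y' s' s'' \<Longrightarrow> Y' \<subseteq> Y \<Longrightarrow> x \<in> Y \<Longrightarrow> same_off Y s (nwrite x i v s'')"
  by (rule same_off_nwrite) (auto intro: same_off_trans)

text \<open>
  \<open>L\<close> and \<open>B\<close> delimit the real numbers that may occur: for unit charges \<open>L\<close> is everything, for
  logarithmic charges it is the set of multiples of \<open>1 / Q\<^sup>2\<close>.
\<close>

locale ram_network = network +
  fixes kn :: "nat \<Rightarrow> nat" and kr :: "real \<Rightarrow> nat" and C :: nat and B :: real
  assumes kn: "k \<le> 2 * n + m + 2 \<Longrightarrow> kn k \<le> C"
    and kr: "x \<in> L \<Longrightarrow> \<bar>x\<bar> \<le> B \<Longrightarrow> kr x \<le> C"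
    and C: "1 \<le> C"
    and B: "(\<Sum>a<m. q a) \<le> B" "v < n \<Longrightarrow> \<bar>W {v}\<bar> + (\<Sum>a<m. q a) \<le> B"
begin

definition input :: "store \<Rightarrow> bool" where
  "input s \<longleftrightarrow> nats s ''n'' 0 = n \<and> nats s ''m'' 0 = m \<and>
     (\<forall>a<m. nats s ''tail'' a = src a \<and> nats s ''head'' a = dst a)"

abbreviation flow :: "store \<Rightarrow> bool" where
  "flow s \<equiv> preflow (nats s ''d'') (reals s ''e'') (reals s ''r'') (reals s ''rr'')"

abbreviation clear :: "nat \<Rightarrow> nat \<Rightarrow> store \<Rightarrow> bool" where
  "clear k i s \<equiv> cleared k i (nats s ''d'') (reals s ''e'') (reals s ''r'') (reals s ''rr'')"

abbreviation stable :: "store \<Rightarrow> bool" where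
  "stable s \<equiv> idle n (nats s ''d'') (reals s ''e'')"

lemma input_same_off:
  "input s \<Longrightarrow> same_off Y s s' \<Longrightarrow> Y \<inter> {''n'', ''m'', ''tail'', ''head''} = {} \<Longrightarrow> input s'"
  unfolding input_def same_off_def by (auto simp: disjoint_iff)

lemma kn_0: "kn 0 \<le> C" and kn_1: "kn (Suc 0) \<le> C"
  using kn by auto

lemma preflow_charges:
  assumes "preflow d e r r'"
  shows "v < n \<Longrightarrow> kr (e v) \<le> C" and "a < m \<Longrightarrow> kr (r a) \<le> C" and "a < m \<Longrightarrow> kr (r' a) \<le> C"
proof -
  note b = preflow_bound[OF assms]
  show "v < n \<Longrightarrow> kr (e v) \<le> C"
    using assms b(3)[of v] B(2)[of v] unfolding preflow_def by (intro kr) auto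
  show "a < m \<Longrightarrow> kr (r a) \<le> C"
    using assms b(1)[of a] B(1) unfolding preflow_def by (intro kr) auto
  show "a < m \<Longrightarrow> kr (r' a) \<le> C"
    using assms b(2)[of a] B(1) unfolding preflow_def by (intro kr) auto
qed

text \<open>This test needs the summand \<open>2 * n\<close> in the bound of the locale, since
  \<open>d u + (k + 1)\<close> can reach that value.\<close>

lemma charge_Admissible:
  assumes "input s" "nats s ''k'' 0 = k" "k < n" "nats s ''a'' 0 = a" "a < m"
    "nats s z a < n" "nats s z' a < n" "\<And>v. v < n \<Longrightarrow> nats s ''d'' v \<le> n"
  shows "tcost kn kr s (Admissible z z') \<le> 60 * C"
proof -
  have "nats s ''d'' (nats s z a) \<le> n" "nats s ''d'' (nats s z' a) \<le> n"
    using assms by auto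
  then have "kn (nats s z a) \<le> C" "kn (nats s z' a) \<le> C" "kn a \<le> C" "kn k \<le> C" "kn n \<le> C"
    "kn (Suc k) \<le> C" "kn (nats s ''d'' (nats s z a)) \<le> C" "kn (nats s ''d'' (nats s z' a)) \<le> C"
    "kn (Suc (nats s ''d'' (nats s z' a))) \<le> C"
    "kn (Suc (nats s ''d'' (nats s z a) + k)) \<le> C"
    using assms(3,5-7) by (auto intro!: kn)
  then show ?thesis
    using assms C kn_0 kn_1 by (simp add: Admissible_def NEq_def Let_def input_def)
qed

lemma val_Admissible:
  assumes "input s" "nats s ''k'' 0 = k" "nats s ''a'' 0 = a"
  shows "tval s (Admissible z z') \<longleftrightarrow>
    Suc (nats s ''d'' (nats s z a) + k) = n \<and> nats s ''d'' (nats s z a) = Suc (nats s ''d'' (nats s z' a))"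
  using assms by (simp add: Admissible_def Let_def input_def)

text \<open>\<open>Push\<close> with its arrays exchanged implements \<open>push_back\<close>.
  Preservation of \<open>stable\<close> is recorded because the rounds continue after the last
  active vertex has gone.\<close>

lemma runs_Step:
  assumes inp: "input s" and fl: "flow s" and cl: "clear k a s"
    and k: "nats s ''k'' 0 = k" "k < n" and a: "nats s ''a'' 0 = a" "a < m"
  shows "runs kn kr Step (180 * C)
    (\<lambda>s'. same_off {''skip''} s s' \<and> flow s' \<and> clear k (Suc a) s' \<and> (stable s \<longrightarrow> stable s')) s"
proof (rule runs_straight)
  let ?s' = "effect Step s" and ?d = "nats s ''d''" and ?e = "reals s ''e''"
    and ?r = "reals s ''r''" and ?r' = "reals s ''rr''"
  show "straight Step" by (simp add: Step_def Skip_def)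
  have tail: "nats s ''tail'' a = src a" and head: "nats s ''head'' a = dst a"
    using inp a unfolding input_def by auto
  note ar = arc[OF a(2)]
  have dn: "?d v \<le> n" if "v < n" for v using fl that unfolding preflow_def by blast
  have c1: "tcost kn kr s (Admissible ''tail'' ''head'') \<le> 60 * C"
    and c2: "tcost kn kr s (Admissible ''head'' ''tail'') \<le> 60 * C"
    using charge_Admissible[OF inp k a] dn ar tail head by simp_all
  have kna: "kn a \<le> C" "kn (src a) \<le> C" "kn (dst a) \<le> C"
    using ar a(2) by (auto intro!: kn)
  note val = val_Admissible[OF inp k(1) a(1)]
  note kn = kn_0 kna C
  note cs = preflow_charges[OF fl]
  consider (ahead) "tval s (Admissible ''tail'' ''head'')"
    | (behind) "\<not> tval s (Admissible ''tail'' ''head'')" "tval s (Admissible ''head'' ''tail'')"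
    | (none) "\<not> tval s (Admissible ''tail'' ''head'')" "\<not> tval s (Admissible ''head'' ''tail'')"
    by blast
  then have "charge kn kr Step s \<le> 180 * C \<and> (same_off {''skip''} s ?s' \<and> flow ?s' \<and>
    clear k (Suc a) ?s' \<and> (stable s \<longrightarrow> stable ?s'))"
  proof cases
    case ahead
    define t where "t = min (?e (src a)) (?r a)"
    have adm: "Suc (?d (src a) + k) = n" "?d (src a) = Suc (?d (dst a))"
      using ahead unfolding val tail head by auto
    note p = push[OF a(2) fl cl adm t_def]
    note p_cs = preflow_charges[OF p(1)]
    have ch: "charge kn kr (Push ''tail'' ''head'' ''r'' ''rr'') s \<le> 60 * C"
      by (rule charge_Push[where t = t and a = a and u = "src a" and v = "dst a"])
        (use a tail head ar kn cs p_cs(1)[of "src a"] p_cs(1)[of "dst a"] p_cs(2,3)[of a] in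
          \<open>simp_all add: t_def\<close>)
    note eff = effect_Push[where x = "''r''" and y = "''rr''" and s = s, OF _ _ _ _ _ a(1) tail head _ t_def]
    have s': "?s' = effect (Push ''tail'' ''head'' ''r'' ''rr'') s"
      unfolding Step_def using ahead by simp
    have "nats ?s' = nats s" "reals ?s' ''e'' = ?e(src a := ?e (src a) - t, dst a := ?e (dst a) + t)"
      "reals ?s' ''r'' = ?r(a := ?r a - t)" "reals ?s' ''rr'' = ?r'(a := ?r' a + t)"
      unfolding s' using eff ar by simp_all
    then have "same_off {''skip''} s ?s' \<and> flow ?s' \<and>
      clear k (Suc a) ?s' \<and> (stable s \<longrightarrow> stable ?s')"
      by (intro conjI impI) (simp_all only: same_off_def p simp_thms)
    then show ?thesis
      using ch ahead c1 by (simp add: Step_def)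
  next
    case behind
    define t where "t = min (?e (dst a)) (?r' a)"
    have adm: "Suc (?d (dst a) + k) = n" "?d (dst a) = Suc (?d (src a))"
      using behind unfolding val tail head by auto
    note p = push_back[OF a(2) fl cl adm t_def]
    note p_cs = preflow_charges[OF p(1)]
    have ch: "charge kn kr (Push ''head'' ''tail'' ''rr'' ''r'') s \<le> 60 * C"
      by (rule charge_Push[where t = t and a = a and u = "dst a" and v = "src a"])
        (use a tail head ar kn cs p_cs(1)[of "src a"] p_cs(1)[of "dst a"] p_cs(2,3)[of a] in
          \<open>simp_all add: t_def\<close>)
    note eff = effect_Push[where x = "''rr''" and y = "''r''" and s = s, OF _ _ _ _ _ a(1) head tail _ t_def]
    have s': "?s' = effect (Push ''head'' ''tail'' ''rr'' ''r'') s"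
      unfolding Step_def using behind by simp
    have "nats ?s' = nats s" "reals ?s' ''e'' = ?e(dst a := ?e (dst a) - t, src a := ?e (src a) + t)"
      "reals ?s' ''r'' = ?r(a := ?r a + t)" "reals ?s' ''rr'' = ?r'(a := ?r' a - t)"
      unfolding s' using eff ar by simp_all
    then have "same_off {''skip''} s ?s' \<and> flow ?s' \<and>
      clear k (Suc a) ?s' \<and> (stable s \<longrightarrow> stable ?s')"
      by (intro conjI impI) (simp_all only: same_off_def p simp_thms)
    then show ?thesis
      using ch behind c1 c2 by (simp add: Step_def)
  next
    case none
    then have "clear k (Suc a) s"
      using cleared_skip[OF cl] unfolding val tail head by blast
    moreover have "?s' = nwrite ''skip'' 0 0 s"
      unfolding Step_def Skip_def using none by simp
    ultimately show ?thesis
      using none c1 c2 fl kn_0 C by (simp add: Step_def Skip_def same_off_def)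
  qed
  then show "charge kn kr Step s \<le> 180 * C" and "same_off {''skip''} s ?s' \<and> flow ?s' \<and>
    clear k (Suc a) ?s' \<and> (stable s \<longrightarrow> stable ?s')" by blast+
qed

lemma runs_For_frame:
  assumes inp: "input s" and start: "P 0 (nwrite x 0 0 s)"
    and body: "\<And>i s'. i < b \<Longrightarrow> same_off Y s s' \<Longrightarrow> nats s' x 0 = i \<Longrightarrow> P i s' \<Longrightarrow>
      runs kn kr p T (\<lambda>s''. same_off Y' s' s'' \<and> P (Suc i) (nwrite x 0 (Suc i) s'')) s'"
    and Y: "Y' \<subseteq> Y" "x \<in> Y" "x \<notin> Y'"
    and bound: "(e, b) \<in> {(NVar ''n'', n), (NVar ''m'', m), (NAdd (NVar ''n'') (NConst 1), n + 1)}"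
    and fixed: "Y \<inter> {''n'', ''m'', ''tail'', ''head''} = {}"
  shows "runs kn kr (For x e p) ((b + 1) * (T + 20 * C)) (\<lambda>s'. same_off Y s s' \<and> P b s') s"
proof -
  let ?I = "\<lambda>i s'. same_off Y s s' \<and> nats s' x 0 = i \<and> P i s'"
  have "runs kn kr (For x e p) ((b + 1) * (T + 20 * C)) (?I b) s"
  proof (rule runs_For[where I = ?I and n = b])
    show "?I 0 (nwrite x 0 0 s)"
      using start Y(2) by (simp add: same_off_nwrite same_off_refl)
    show "nval s' e = b \<and> ncost kn s' e \<le> 4 * C" if "?I i s'" for i s'
      using input_same_off[OF inp _ fixed, of s'] that bound kn[of n] kn[of m] kn[of "Suc n"] kn_0 kn_1
      by (auto simp: input_def)
    fix i s' assume "i < b" and I: "?I i s'"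
    show "runs kn kr p T (\<lambda>s''. nats s'' x 0 = i \<and> ?I (Suc i) (nwrite x 0 (Suc i) s'')) s'"
    proof (rule runs_mono[OF body order_refl])
      fix s'' assume *: "same_off Y' s' s'' \<and> P (Suc i) (nwrite x 0 (Suc i) s'')"
      have "nats s'' x 0 = i"
        using * I same_off_nats[of Y' s' s'' x] Y(3) by simp
      moreover have "same_off Y s (nwrite x 0 (Suc i) s'')"
        using * I Y by (blast intro: same_off_step)
      ultimately show "nats s'' x 0 = i \<and> ?I (Suc i) (nwrite x 0 (Suc i) s'')"
        using * by simp
    qed (use I \<open>i < b\<close> in blast)+
  next
    show "kn k \<le> C" if "k \<le> Suc b" for k
      using that bound by (intro kn) auto
  qed (use C in auto)
  then show ?thesis
    by (rule runs_mono) simp_all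
qed

section \<open>The loops of one round and their repetition\<close>

lemma runs_arcs:
  assumes inp: "input s" and fl: "flow s" and cl: "clear k 0 s"
    and k: "nats s ''k'' 0 = k" "k < n"
  shows "runs kn kr (For ''a'' (NVar ''m'') Step) ((m + 1) * (200 * C))
    (\<lambda>s'. same_off {''skip'', ''a''} s s' \<and> flow s' \<and> clear (Suc k) 0 s' \<and> (stable s \<longrightarrow> stable s')) s"
proof -
  let ?P = "\<lambda>a s'. flow s' \<and> clear k a s' \<and> (stable s \<longrightarrow> stable s')"
  have "runs kn kr (For ''a'' (NVar ''m'') Step) ((m + 1) * (180 * C + 20 * C))
    (\<lambda>s'. same_off {''skip'', ''a''} s s' \<and> ?P m s') s"
  proof (rule runs_For_frame[where P = ?P and Y' = "{''skip''}"])
    fix a s' assume "a < m" and same: "same_off {''skip'', ''a''} s s'" and "nats s' ''a'' 0 = a"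
      and P: "?P a s'"
    moreover have "input s'"
      using input_same_off[OF inp same] by simp
    moreover have "nats s' ''k'' 0 = k"
      using k(1) same_off_nats[OF same, of "''k''"] by simp
    ultimately have "runs kn kr Step (180 * C) (\<lambda>s''. same_off {''skip''} s' s'' \<and> flow s'' \<and>
        clear k (Suc a) s'' \<and> (stable s' \<longrightarrow> stable s'')) s'"
      using k(2) by (intro runs_Step) simp_all
    then show "runs kn kr Step (180 * C)
      (\<lambda>s''. same_off {''skip''} s' s'' \<and> ?P (Suc a) (nwrite ''a'' 0 (Suc a) s'')) s'"
      by (rule runs_mono) (use P in auto)
  qed (use fl cl inp in simp_all)
  then show ?thesis
    by (rule runs_mono) (simp_all add: cleared_next)
qed

lemma runs_Pass:
  assumes inp: "input s" and fl: "flow s"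
  shows "runs kn kr Pass ((n + 1) * ((m + 1) * (200 * C) + 20 * C))
    (\<lambda>s'. same_off {''skip'', ''a'', ''k''} s s' \<and> flow s' \<and> clear n 0 s' \<and> (stable s \<longrightarrow> stable s')) s"
  unfolding Pass_def
proof -
  let ?P = "\<lambda>k s'. flow s' \<and> clear k 0 s' \<and> (stable s \<longrightarrow> stable s')"
  let ?p = "For ''a'' (NVar ''m'') Step"
  show "runs kn kr (For ''k'' (NVar ''n'') ?p) ((n + 1) * ((m + 1) * (200 * C) + 20 * C))
    (\<lambda>s'. same_off {''skip'', ''a'', ''k''} s s' \<and> ?P n s') s"
  proof (rule runs_For_frame[where P = ?P and Y' = "{''skip'', ''a''}"])
    fix k s' assume "k < n" and same: "same_off {''skip'', ''a'', ''k''} s s'"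
      and "nats s' ''k'' 0 = k" and P: "?P k s'"
    moreover have "input s'"
      using input_same_off[OF inp same] by simp
    ultimately have "runs kn kr ?p ((m + 1) * (200 * C)) (\<lambda>s''. same_off {''skip'', ''a''} s' s'' \<and>
      flow s'' \<and> clear (Suc k) 0 s'' \<and> (stable s' \<longrightarrow> stable s'')) s'"
      by (intro runs_arcs) simp_all
    then show "runs kn kr ?p ((m + 1) * (200 * C))
      (\<lambda>s''. same_off {''skip'', ''a''} s' s'' \<and> ?P (Suc k) (nwrite ''k'' 0 (Suc k) s'')) s'"
      by (rule runs_mono) (use P in auto)
  qed (use fl cleared_start inp in simp_all)
qed

text \<open>The invariant after \<open>p\<close> rounds.\<close>

abbreviation progress :: "nat \<Rightarrow> store \<Rightarrow> bool" where
  "progress p s \<equiv> stable s \<or> p \<le> (\<Sum>v<n. nats s ''d'' v)"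

text \<open>The new label of \<open>v\<close> depends on \<open>d v\<close> and \<open>e v\<close>
  alone, so updating in place agrees with the simultaneous \<open>relabel\<close>.\<close>

lemma runs_Relabel:
  assumes inp: "input s" and fl: "flow s"
  shows "runs kn kr Relabel ((n + 1) * (40 * C))
    (\<lambda>s'. same_off {''skip'', ''v'', ''d''} s s' \<and> reals s' = reals s \<and>
      nats s' ''d'' = relabel n (nats s ''d'') (reals s ''e'')) s"
  unfolding Relabel_def
proof -
  let ?d = "nats s ''d''" and ?e = "reals s ''e''"
  let ?d' = "relabel n ?d ?e"
  let ?p = "If (TAnd (RLess (RConst 0) (RCell ''e'' (NVar ''v'')))
               (NLess (NCell ''d'' (NVar ''v'')) (NVar ''n'')))
        (NAssign ''d'' (NVar ''v'') (NAdd (NCell ''d'' (NVar ''v'')) (NConst 1))) Skip"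
  let ?P = "\<lambda>i s'. reals s' = reals s \<and>
    nats s' ''d'' = (\<lambda>v. if v < i then ?d' v else ?d v)"
  \<comment> \<open>The constant 0 in the test is charged like any other number.\<close>
  have kr0: "kr 0 \<le> C"
  proof -
    have "0 \<le> (\<Sum>a<m. q a)" by (rule sum_nonneg) (simp add: q_nonneg)
    then show ?thesis using B(1) by (intro kr L0) simp
  qed
  have "runs kn kr (For ''v'' (NVar ''n'') ?p) ((n + 1) * (20 * C + 20 * C))
    (\<lambda>s'. same_off {''skip'', ''v'', ''d''} s s' \<and> ?P n s') s"
  proof (rule runs_For_frame[where P = ?P and Y' = "{''skip'', ''d''}"])
    fix i s' assume i: "i < n" and same: "same_off {''skip'', ''v'', ''d''} s s'"
      and v: "nats s' ''v'' 0 = i" and P: "?P i s'"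
    have n: "nats s' ''n'' 0 = n"
      using input_same_off[OF inp same] by (simp add: input_def)
    have d: "nats s' ''d'' i = ?d i" and e: "reals s' ''e'' i = ?e i"
      using P by simp_all
    have le: "?d i \<le> n"
      using fl i unfolding preflow_def by blast
    have kns: "kn i \<le> C" "kn n \<le> C" "kn (?d i) \<le> C" "kn (Suc (?d i)) \<le> C" "kr (?e i) \<le> C"
      using i le preflow_charges(1)[OF fl i] by (auto intro!: kn)
    show "runs kn kr ?p (20 * C) (\<lambda>s''. same_off {''skip'', ''d''} s' s'' \<and>
        ?P (Suc i) (nwrite ''v'' 0 (Suc i) s'')) s'"
    proof (rule runs_straight)
      show "straight ?p" by (simp add: Skip_def)
      show "charge kn kr ?p s' \<le> 20 * C"
        using kns kn_0 kn_1 kr0 C v n d e by (simp add: Skip_def)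
      have "same_off {''skip'', ''d''} s' (effect ?p s')"
        by (simp add: Skip_def same_off_def)
      moreover have "reals (effect ?p s') = reals s"
        using P by (simp add: Skip_def)
      moreover have "nats (effect ?p s') ''d'' = (\<lambda>v. if v < Suc i then ?d' v else ?d v)"
        using P v n d e i by (auto simp: Skip_def relabel_def fun_eq_iff less_Suc_eq)
      ultimately show "same_off {''skip'', ''d''} s' (effect ?p s') \<and>
          ?P (Suc i) (nwrite ''v'' 0 (Suc i) (effect ?p s'))"
        by (simp del: effect.simps)
    qed
  qed (use inp in simp_all)
  then show "runs kn kr (For ''v'' (NVar ''n'') ?p) ((n + 1) * (40 * C))
    (\<lambda>s'. same_off {''skip'', ''v'', ''d''} s s' \<and> reals s' = reals s \<and> nats s' ''d'' = ?d') s"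
    by (rule runs_mono) (auto simp: relabel_def fun_eq_iff)
qed

definition round_time :: nat where
  "round_time = (n + 1) * ((m + 1) * (200 * C) + 20 * C) + (n + 1) * (40 * C)"

lemma runs_Round:
  assumes inp: "input s" and fl: "flow s" and pr: "progress p s"
  shows "runs kn kr (Seq Pass Relabel) round_time
    (\<lambda>s'. same_off {''skip'', ''a'', ''k'', ''v'', ''d''} s s' \<and> flow s' \<and> progress (Suc p) s') s"
  unfolding round_time_def
proof (rule runs_Seq[OF runs_Pass[OF inp fl]])
  fix s1 assume s1: "same_off {''skip'', ''a'', ''k''} s s1 \<and> flow s1 \<and> clear n 0 s1 \<and>
    (stable s \<longrightarrow> stable s1)"
  have inp1: "input s1"
    using input_same_off[OF inp, of _ s1] s1 by fastforce
  have d: "nats s1 ''d'' = nats s ''d''"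
    using s1 same_off_nats[of _ s s1 "''d''"] by fastforce
  have pr1: "progress p s1" using pr s1 unfolding d by blast
  have fl1: "flow s1" using s1 by blast
  show "runs kn kr Relabel ((n + 1) * (40 * C))
    (\<lambda>s'. same_off {''skip'', ''a'', ''k'', ''v'', ''d''} s s' \<and> flow s' \<and> progress (Suc p) s') s1"
  proof (rule runs_mono[OF runs_Relabel[OF inp1 fl1] order_refl])
    fix s2 assume s2: "same_off {''skip'', ''v'', ''d''} s1 s2 \<and> reals s2 = reals s1 \<and>
      nats s2 ''d'' = relabel n (nats s1 ''d'') (reals s1 ''e'')"
    have "same_off {''skip'', ''a'', ''k'', ''v'', ''d''} s s2"
      by (rule same_off_trans[OF conjunct1[OF s1] conjunct1[OF s2]]) blast
    moreover have "flow s2"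
      using preflow_relabel[of "nats s1 ''d''"] s1 s2 by simp
    \<comment> \<open>A stable state stays stable; otherwise relabelling adds at least one to the
      sum of the labels, which the pass has not touched.\<close>
    moreover have "progress (Suc p) s2"
    proof (cases "stable s1")
      case True
      then show ?thesis using idle_relabel s2 by simp
    next
      case False
      then show ?thesis using sum_relabel[OF False fl1] pr1 s2 by auto
    qed
    ultimately show "same_off {''skip'', ''a'', ''k'', ''v'', ''d''} s s2 \<and> flow s2 \<and>
      progress (Suc p) s2" by blast
  qed
qed

lemma runs_row:
  assumes inp: "input s" and fl: "flow s" and pr: "progress p s"
  shows "runs kn kr (For ''j'' (NVar ''n'') (Seq Pass Relabel)) ((n + 1) * (round_time + 20 * C))
    (\<lambda>s'. same_off {''skip'', ''a'', ''k'', ''v'', ''d'', ''j''} s s' \<and> flow s' \<and>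
      progress (p + n) s') s"
proof -
  let ?P = "\<lambda>j s'. flow s' \<and> progress (p + j) s'"
  show ?thesis
  proof (rule runs_For_frame[where P = ?P and Y' = "{''skip'', ''a'', ''k'', ''v'', ''d''}"])
    fix j s' assume same: "same_off {''skip'', ''a'', ''k'', ''v'', ''d'', ''j''} s s'" and P: "?P j s'"
    have "input s'"
      using input_same_off[OF inp same] by simp
    then have "runs kn kr (Seq Pass Relabel) round_time
      (\<lambda>s''. same_off {''skip'', ''a'', ''k'', ''v'', ''d''} s' s'' \<and> flow s'' \<and>
        progress (Suc (p + j)) s'') s'"
      by (rule runs_Round) (use P in blast)+
    then show "runs kn kr (Seq Pass Relabel) round_time
      (\<lambda>s''. same_off {''skip'', ''a'', ''k'', ''v'', ''d''} s' s'' \<and>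
        ?P (Suc j) (nwrite ''j'' 0 (Suc j) s'')) s'"
      by (rule runs_mono) auto
  qed (use fl pr inp in simp_all)
qed

text \<open>After \<open>n\<close> rows of \<open>n\<close> rounds \<open>progress\<close> holds for
  \<open>n * n\<close>, and \<open>idle_of_sum\<close> turns its second alternative into
  stability.\<close>

lemma runs_Rounds:
  assumes inp: "input s" and fl: "flow s"
  shows "runs kn kr Rounds ((n + 1) * ((n + 1) * (round_time + 20 * C) + 20 * C))
    (\<lambda>s'. same_off {''skip'', ''a'', ''k'', ''v'', ''d'', ''j'', ''i''} s s' \<and> flow s' \<and> stable s') s"
proof -
  let ?P = "\<lambda>i s'. flow s' \<and> progress (i * n) s'"
  let ?Y = "{''skip'', ''a'', ''k'', ''v'', ''d'', ''j''}"
  have "runs kn kr Rounds ((n + 1) * ((n + 1) * (round_time + 20 * C) + 20 * C))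
    (\<lambda>s'. same_off {''skip'', ''a'', ''k'', ''v'', ''d'', ''j'', ''i''} s s' \<and> ?P n s') s"
    unfolding Rounds_def
  proof (rule runs_For_frame[where P = ?P and Y' = ?Y])
    fix i s' assume same: "same_off {''skip'', ''a'', ''k'', ''v'', ''d'', ''j'', ''i''} s s'"
      and P: "?P i s'"
    have "input s'"
      using input_same_off[OF inp same] by simp
    then have "runs kn kr (For ''j'' (NVar ''n'') (Seq Pass Relabel)) ((n + 1) * (round_time + 20 * C))
      (\<lambda>s''. same_off ?Y s' s'' \<and> flow s'' \<and> progress (i * n + n) s'') s'"
      by (rule runs_row) (use P in blast)+
    then show "runs kn kr (For ''j'' (NVar ''n'') (Seq Pass Relabel)) ((n + 1) * (round_time + 20 * C))
      (\<lambda>s''. same_off ?Y s' s'' \<and> ?P (Suc i) (nwrite ''i'' 0 (Suc i) s'')) s'"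
      by (rule runs_mono) (auto simp: add.commute)
  qed (use fl inp in simp_all)
  then show ?thesis
    by (rule runs_mono) (use idle_of_sum in auto)
qed

section \<open>Finding an empty level and selecting the vertices above it\<close>

lemma runs_Mark:
  assumes inp: "input s" and d: "\<And>v. v < n \<Longrightarrow> nats s ''d'' v \<le> n"
    and "nats s ''mark'' = (\<lambda>_. 0)"
  shows "runs kn kr Mark ((n + 1) * (30 * C))
    (\<lambda>s'. same_off {''mark'', ''v''} s s' \<and>
      nats s' ''mark'' = (\<lambda>k. if \<exists>v<n. nats s ''d'' v = k then 1 else 0)) s"
proof -
  let ?P = "\<lambda>i s'. nats s' ''mark'' = (\<lambda>k. if \<exists>v<i. nats s ''d'' v = k then 1 else 0)"
  let ?p = "NAssign ''mark'' (NCell ''d'' (NVar ''v'')) (NConst 1)"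
  have "runs kn kr Mark ((n + 1) * (10 * C + 20 * C)) (\<lambda>s'. same_off {''mark'', ''v''} s s' \<and> ?P n s') s"
    unfolding Mark_def
  proof (rule runs_For_frame[where P = ?P and Y' = "{''mark''}"])
    fix i s' assume i: "i < n" and same: "same_off {''mark'', ''v''} s s'"
      and v: "nats s' ''v'' 0 = i" and P: "?P i s'"
    have d': "nats s' ''d'' = nats s ''d''"
      using same_off_nats[OF same, of "''d''"] by simp
    have kns: "kn i \<le> C" "kn (nats s ''d'' i) \<le> C"
      using i d[OF i] by (auto intro!: kn)
    show "runs kn kr ?p (10 * C) (\<lambda>s''. same_off {''mark''} s' s'' \<and>
        ?P (Suc i) (nwrite ''v'' 0 (Suc i) s'')) s'"
    proof (rule runs_straight)
      show "charge kn kr ?p s' \<le> 10 * C"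
        using kns kn_0 kn_1 C v d' by simp
      have "nats (effect ?p s') ''mark'' = (\<lambda>k. if \<exists>v<Suc i. nats s ''d'' v = k then 1 else 0)"
        using P v d' by (auto simp: fun_eq_iff less_Suc_eq)
      then show "same_off {''mark''} s' (effect ?p s') \<and>
          ?P (Suc i) (nwrite ''v'' 0 (Suc i) (effect ?p s'))"
        by (simp add: same_off_def)
    qed simp
  qed (use inp assms(3) in simp_all)
  then show ?thesis by (rule runs_mono) simp_all
qed

lemma runs_Gap:
  assumes inp: "input s" and mark: "\<And>k. nats s ''mark'' k \<le> 1"
    and gap: "h \<le> n" "nats s ''mark'' h = 0"
  shows "runs kn kr Gap ((n + 2) * (40 * C))
    (\<lambda>s'. same_off {''skip'', ''k'', ''g''} s s' \<and>
      nats s' ''g'' 0 \<le> n \<and> nats s ''mark'' (nats s' ''g'' 0) = 0) s"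
proof -
  \<comment> \<open>Conditional, since no empty level need have been met below \<open>k\<close>; at
    the end \<open>h\<close> supplies the premise.\<close>
  let ?P = "\<lambda>k s'. (\<exists>h<k. nats s ''mark'' h = 0) \<longrightarrow>
    nats s' ''g'' 0 < k \<and> nats s ''mark'' (nats s' ''g'' 0) = 0"
  let ?p = "If (NLess (NCell ''mark'' (NVar ''k'')) (NConst 1)) (NAssign ''g'' (NConst 0) (NVar ''k'')) Skip"
  have "runs kn kr Gap ((n + 1 + 1) * (20 * C + 20 * C))
    (\<lambda>s'. same_off {''skip'', ''k'', ''g''} s s' \<and> ?P (n + 1) s') s"
    unfolding Gap_def
  proof (rule runs_For_frame[where P = ?P and Y' = "{''skip'', ''g''}"])
    fix k s' assume k: "k < n + 1" and same: "same_off {''skip'', ''k'', ''g''} s s'"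
      and k': "nats s' ''k'' 0 = k" and P: "?P k s'"
    have mk: "nats s' ''mark'' = nats s ''mark''"
      using same_off_nats[OF same, of "''mark''"] by simp
    have kns: "kn k \<le> C" "kn (nats s ''mark'' k) \<le> C"
      using k mark[of k] by (auto intro!: kn)
    show "runs kn kr ?p (20 * C) (\<lambda>s''. same_off {''skip'', ''g''} s' s'' \<and>
        ?P (Suc k) (nwrite ''k'' 0 (Suc k) s'')) s'"
    proof (rule runs_straight)
      show "straight ?p" by (simp add: Skip_def)
      show "charge kn kr ?p s' \<le> 20 * C"
        using kns kn_0 kn_1 C k' mk by (simp add: Skip_def)
      have "same_off {''skip'', ''g''} s' (effect ?p s')"
        by (simp add: same_off_def Skip_def)
      moreover have "?P (Suc k) (effect ?p s')"
        using P k' mk by (auto simp: Skip_def less_Suc_eq)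
      ultimately show "same_off {''skip'', ''g''} s' (effect ?p s') \<and>
          ?P (Suc k) (nwrite ''k'' 0 (Suc k) (effect ?p s'))"
        by (simp del: effect.simps)
    qed
  qed (use inp in simp_all)
  then show ?thesis
    by (rule runs_mono) (use gap in \<open>auto simp: less_Suc_eq_le\<close>)
qed

lemma runs_Select:
  assumes inp: "input s" and d: "\<And>v. v < n \<Longrightarrow> nats s ''d'' v \<le> n"
    and g: "nats s ''g'' 0 = g" "g \<le> n" and "nats s ''X'' = (\<lambda>_. 0)"
  shows "runs kn kr Select ((n + 1) * (40 * C))
    (\<lambda>s'. nats s' ''X'' = (\<lambda>v. if v < n \<and> g < nats s ''d'' v then 1 else 0)) s"
proof -
  let ?P = "\<lambda>i s'. nats s' ''X'' = (\<lambda>v. if v < i \<and> g < nats s ''d'' v then 1 else 0)"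
  let ?p = "If (NLess (NVar ''g'') (NCell ''d'' (NVar ''v''))) (NAssign ''X'' (NVar ''v'') (NConst 1)) Skip"
  have "runs kn kr Select ((n + 1) * (20 * C + 20 * C))
    (\<lambda>s'. same_off {''skip'', ''X'', ''v''} s s' \<and> ?P n s') s"
    unfolding Select_def
  proof (rule runs_For_frame[where P = ?P and Y' = "{''skip'', ''X''}"])
    fix i s' assume i: "i < n" and same: "same_off {''skip'', ''X'', ''v''} s s'"
      and v: "nats s' ''v'' 0 = i" and P: "?P i s'"
    have d': "nats s' ''d'' = nats s ''d''" and g': "nats s' ''g'' 0 = g"
      using same_off_nats[OF same, of "''d''"] same_off_nats[OF same, of "''g''"] g by simp_all
    have kns: "kn i \<le> C" "kn g \<le> C" "kn (nats s ''d'' i) \<le> C"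
      using i g(2) d[OF i] by (auto intro!: kn)
    show "runs kn kr ?p (20 * C) (\<lambda>s''. same_off {''skip'', ''X''} s' s'' \<and>
        ?P (Suc i) (nwrite ''v'' 0 (Suc i) s'')) s'"
    proof (rule runs_straight)
      show "straight ?p" by (simp add: Skip_def)
      show "charge kn kr ?p s' \<le> 20 * C"
        using kns kn_0 kn_1 C v d' g' by (simp add: Skip_def)
      have "same_off {''skip'', ''X''} s' (effect ?p s')"
        by (simp add: same_off_def Skip_def)
      moreover have "?P (Suc i) (effect ?p s')"
        using P v d' g' by (auto simp: Skip_def fun_eq_iff less_Suc_eq)
      ultimately show "same_off {''skip'', ''X''} s' (effect ?p s') \<and>
          ?P (Suc i) (nwrite ''v'' 0 (Suc i) (effect ?p s'))"
        by (simp del: effect.simps)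
    qed
  qed (use inp assms(5) in simp_all)
  then show ?thesis by (rule runs_mono) simp_all
qed

definition flow_time :: nat where
  "flow_time = (n + 1) * ((n + 1) * (round_time + 20 * C) + 20 * C) +
     ((n + 1) * (30 * C) + ((n + 2) * (40 * C) + (n + 1) * (40 * C)))"

lemma runs_flow:
  assumes inp: "input s" and fl: "flow s"
    and zero: "nats s ''mark'' = (\<lambda>_. 0)" "nats s ''X'' = (\<lambda>_. 0)"
  shows "runs kn kr (Seq Rounds (Seq Mark (Seq Gap Select))) flow_time
    (\<lambda>s'. \<exists>S\<subseteq>{..<n}. nats s' ''X'' = (\<lambda>v. if v \<in> S then 1 else 0) \<and> (\<forall>T\<subseteq>{..<n}. W T \<le> W S)) s"
  unfolding flow_time_def
proof (rule runs_Seq[OF runs_Rounds[OF inp fl]])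
  let ?Y = "{''skip'', ''a'', ''k'', ''v'', ''d'', ''j'', ''i''}"
  fix s1 assume s1: "same_off ?Y s s1 \<and> flow s1 \<and> stable s1"
  note same1 = conjunct1[OF s1]
  have inp1: "input s1"
    using input_same_off[OF inp same1] by simp
  have zero1: "nats s1 ''mark'' = (\<lambda>_. 0)" "nats s1 ''X'' = (\<lambda>_. 0)"
    using same_off_nats[OF same1] zero by simp_all
  let ?d = "nats s1 ''d''"
  have d: "?d v \<le> n" if "v < n" for v
    using s1 that unfolding preflow_def by blast
  show "runs kn kr (Seq Mark (Seq Gap Select))
     ((n + 1) * (30 * C) + ((n + 2) * (40 * C) + (n + 1) * (40 * C)))
    (\<lambda>s'. \<exists>S\<subseteq>{..<n}. nats s' ''X'' = (\<lambda>v. if v \<in> S then 1 else 0) \<and> (\<forall>T\<subseteq>{..<n}. W T \<le> W S)) s1"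
  proof (rule runs_Seq[OF runs_Mark[OF inp1 d zero1(1)]])
    let ?mark = "\<lambda>k. if \<exists>v<n. ?d v = k then 1 else (0::nat)"
    fix s2 assume s2: "same_off {''mark'', ''v''} s1 s2 \<and> nats s2 ''mark'' = ?mark"
    note same2 = conjunct1[OF s2]
    have inp2: "input s2"
      using input_same_off[OF inp1 same2] by simp
    have d2: "nats s2 ''d'' = ?d" and X2: "nats s2 ''X'' = (\<lambda>_. 0)"
      using same_off_nats[OF same2] zero1 by simp_all
    obtain h where h: "h \<le> n" "\<forall>v<n. ?d v \<noteq> h"
      using exists_gap by blast
    have mark: "nats s2 ''mark'' k \<le> 1" "nats s2 ''mark'' h = 0" for k
      using s2 h(2) by auto
    show "runs kn kr (Seq Gap Select) ((n + 2) * (40 * C) + (n + 1) * (40 * C))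
      (\<lambda>s'. \<exists>S\<subseteq>{..<n}. nats s' ''X'' = (\<lambda>v. if v \<in> S then 1 else 0) \<and> (\<forall>T\<subseteq>{..<n}. W T \<le> W S)) s2"
    proof (rule runs_Seq[OF runs_Gap[OF inp2 mark(1) h(1) mark(2)]])
      fix s3 assume s3: "same_off {''skip'', ''k'', ''g''} s2 s3 \<and> nats s3 ''g'' 0 \<le> n \<and>
        nats s2 ''mark'' (nats s3 ''g'' 0) = 0"
      let ?g = "nats s3 ''g'' 0"
      note same3 = conjunct1[OF s3]
      have inp3: "input s3"
        using input_same_off[OF inp2 same3] by simp
      have d3: "nats s3 ''d'' = ?d" and X3: "nats s3 ''X'' = (\<lambda>_. 0)"
        using same_off_nats[OF same3] d2 X2 by simp_all
      have g: "?g \<le> n" "\<And>v. v < n \<Longrightarrow> ?d v \<noteq> ?g"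
        using s2 s3 by (auto split: if_splits)
      let ?S = "{v. v < n \<and> ?g < ?d v}"
      have opt: "W T \<le> W ?S" if "T \<subseteq> {..<n}" for T
        using s1 g that by (intro optimal_above_gap) auto
      show "runs kn kr Select ((n + 1) * (40 * C))
        (\<lambda>s'. \<exists>S\<subseteq>{..<n}. nats s' ''X'' = (\<lambda>v. if v \<in> S then 1 else 0) \<and> (\<forall>T\<subseteq>{..<n}. W T \<le> W S)) s3"
      proof (rule runs_mono[OF runs_Select[OF inp3 _ refl g(1) X3] order_refl])
        show "nats s3 ''d'' v \<le> n" if "v < n" for v using d[OF that] d3 by simp
        fix s4 assume "nats s4 ''X'' = (\<lambda>v. if v < n \<and> ?g < nats s3 ''d'' v then 1 else 0)"
        then have "nats s4 ''X'' = (\<lambda>v. if v \<in> ?S then 1 else 0)"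
          unfolding d3 by simp
        with opt show "\<exists>S\<subseteq>{..<n}. nats s4 ''X'' = (\<lambda>v. if v \<in> S then 1 else 0) \<and>
            (\<forall>T\<subseteq>{..<n}. W T \<le> W S)"
          by (intro exI[of _ ?S] conjI) auto
      qed
    qed
  qed
qed

text \<open>The exponent counts the nested loops: two for the rounds, one for the levels, one for
  the arcs.\<close>

lemma flow_time_le: "flow_time \<le> 500 * C * (n + m + 1) ^ 4"
proof -
  define N where "N = n + m + 1"
  have le: "n + 1 \<le> N" "m + 1 \<le> N" "1 \<le> N" "n + 2 \<le> 2 * N"
    by (auto simp: N_def)
  have N2: "N * C \<le> N ^ 2 * C" "C \<le> N * C"
    using le(3) by (auto simp: power2_eq_square)
  have "round_time \<le> N * (N * (200 * C) + 20 * C) + N * (40 * C)"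
    unfolding round_time_def using le by (intro add_mono mult_mono) auto
  also have "\<dots> = 200 * (N ^ 2 * C) + 60 * (N * C)"
    by (simp add: power2_eq_square algebra_simps)
  also have "\<dots> \<le> 260 * (N ^ 2 * C)" using N2 by simp
  finally have r: "round_time \<le> 260 * (N ^ 2 * C)" .
  have "flow_time \<le> N * (N * (260 * (N ^ 2 * C) + 20 * C) + 20 * C) +
     (N * (30 * C) + ((2 * N) * (40 * C) + N * (40 * C)))"
    unfolding flow_time_def using le r by (intro add_mono mult_mono) auto
  also have "\<dots> = 260 * (N ^ 4 * C) + 20 * (N ^ 2 * C) + 170 * (N * C)"
    by (simp add: power2_eq_square power4_eq_xxxx algebra_simps)
  also have "\<dots> \<le> 450 * (N ^ 4 * C)"
  proof -
    have "N ^ 2 * C \<le> N ^ 4 * C"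
      using le(3) by (intro mult_right_mono power_increasing) auto
    then show ?thesis using N2 by linarith
  qed
  also have "\<dots> \<le> 500 * C * N ^ 4" by simp
  finally show ?thesis unfolding N_def .
qed

end

section \<open>Initialisation from the data of the instance\<close>

lemma charge_gain:
  assumes v: "nats s ''a'' 0 = i" "nats s z i = u" "reals s ''e'' u = E" "reals s ''c'' i = c"
      "reals s x i = p" "reals s y i = q"
    and le: "kn 0 \<le> C" "kn i \<le> C" "kn u \<le> C" "1 \<le> C" "kr E \<le> C" "kr c \<le> C" "kr p \<le> C" "kr q \<le> C"
      "kr (c * p) \<le> C" "kr (c * q) \<le> C" "kr (c * p - c * q) \<le> C" "kr (E + (c * p - c * q)) \<le> C"
  shows "charge kn kr (RAssign ''e'' (NCell z (NVar ''a'')) (RAdd (RCell ''e'' (NCell z (NVar ''a'')))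
    (RSub (RMul (RCell ''c'' (NVar ''a'')) (RCell x (NVar ''a''))) (RMul (RCell ''c'' (NVar ''a'')) (RCell y (NVar ''a'')))))) s
    \<le> 30 * C"
proof -
  have "charge kn kr (RAssign ''e'' (NCell z (NVar ''a'')) (RAdd (RCell ''e'' (NCell z (NVar ''a'')))
    (RSub (RMul (RCell ''c'' (NVar ''a'')) (RCell x (NVar ''a''))) (RMul (RCell ''c'' (NVar ''a'')) (RCell y (NVar ''a'')))))) s = 
    6 * kn 0 + 6 * kn i + 2 * kn u + kr E + 2 * kr c + kr p + kr q + kr (c * p) + kr (c * q) + kr (c * p - c * q) + kr (E + (c * p - c * q)) + 1"
    by (simp add: v)
  then show ?thesis using le by linarith
qed

text \<open>The instance in terms of arc numbers. \<open>L\<close> and \<open>B\<close> also cover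
  the products with \<open>c\<close>, the only products computed. The factor 12 is 8 + 4:
  \<open>worth {v}\<close> is bounded by \<open>m * (8 * B)\<close> and the sum of the capacities by
  \<open>m * (4 * B)\<close>.\<close>

locale ram_instance =
  fixes n m :: nat and src dst :: "nat \<Rightarrow> nat" and c m11 m12 m21 m22 :: "nat \<Rightarrow> real"
    and L :: "real set" and kn :: "nat \<Rightarrow> nat" and kr :: "real \<Rightarrow> nat" and C :: nat and B :: real
  assumes arc: "a < m \<Longrightarrow> src a < n \<and> dst a < n \<and> src a \<noteq> dst a"
    and supermodular: "a < m \<Longrightarrow> 0 \<le> c a \<and> m12 a + m21 a \<le> m11 a + m22 a"
    and L0: "0 \<in> L"
    and L_add: "x \<in> L \<Longrightarrow> y \<in> L \<Longrightarrow> x + y \<in> L"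
    and L_diff: "x \<in> L \<Longrightarrow> y \<in> L \<Longrightarrow> x - y \<in> L"
    and data: "a < m \<Longrightarrow> x \<in> {c a, m11 a, m12 a, m21 a, m22 a,
       c a * m11 a, c a * m12 a, c a * m21 a, c a * m22 a} \<Longrightarrow> x \<in> L \<and> \<bar>x\<bar> \<le> B"
    and B0: "0 \<le> B"
    and kn: "k \<le> 2 * n + m + 2 \<Longrightarrow> kn k \<le> C"
    and kr: "x \<in> L \<Longrightarrow> \<bar>x\<bar> \<le> 12 * (m + 1) * B \<Longrightarrow> kr x \<le> C"
    and C: "1 \<le> C"
begin

definition cap :: "nat \<Rightarrow> real" where
  "cap a = c a * m11 a + c a * m22 a - c a * m12 a - c a * m21 a"

definition gain :: "nat \<Rightarrow> nat \<Rightarrow> real" where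
  "gain a v = (if src a = v then c a * m11 a - c a * m21 a else 0) +
     (if dst a = v then c a * m21 a - c a * m22 a else 0)"

text \<open>The \<open>cut_value\<close> of the initial state. Up to a constant it is the weight of
  the partition with first part \<open>S\<close>.\<close>

definition worth :: "nat set \<Rightarrow> real" where
  "worth S = (\<Sum>v\<in>S. \<Sum>a<m. gain a v) - (\<Sum>a<m. if src a \<in> S \<and> dst a \<notin> S then cap a else 0)"

lemma cm:
  assumes "a < m"
  shows "c a * m11 a \<in> L" "c a * m12 a \<in> L" "c a * m21 a \<in> L" "c a * m22 a \<in> L"
    and "\<bar>c a * m11 a\<bar> \<le> B" "\<bar>c a * m12 a\<bar> \<le> B" "\<bar>c a * m21 a\<bar> \<le> B" "\<bar>c a * m22 a\<bar> \<le> B"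
  using data[OF assms] by simp_all

lemma gain_L:
  assumes "a < m"
  shows "gain a v \<in> L"
proof -
  have "c a * m11 a - c a * m21 a \<in> L" "c a * m21 a - c a * m22 a \<in> L"
    by (intro L_diff cm assms)+
  then show ?thesis
    unfolding gain_def by (intro L_add) (simp_all add: L0)
qed

lemma sum_gain_L: "i \<le> m \<Longrightarrow> (\<Sum>a<i. gain a v) \<in> L"
proof (induction i)
  case (Suc i)
  then show ?case unfolding sum.lessThan_Suc by (intro L_add gain_L) simp_all
qed (simp add: L0)

lemma gain_bound:
  assumes "a < m"
  shows "\<bar>gain a v\<bar> \<le> 4 * B"
proof -
  have "\<bar>c a * m11 a - c a * m21 a\<bar> \<le> 2 * B" "\<bar>c a * m21 a - c a * m22 a\<bar> \<le> 2 * B"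
    by (rule abs_leI; use cm(5-8)[OF assms, unfolded abs_le_iff] in linarith)+
  moreover have "0 \<le> 2 * B" using B0 by simp
  ultimately have "\<bar>if src a = v then c a * m11 a - c a * m21 a else 0\<bar> \<le> 2 * B"
    and "\<bar>if dst a = v then c a * m21 a - c a * m22 a else 0\<bar> \<le> 2 * B" by simp_all
  then show ?thesis
    unfolding gain_def by (intro order_trans[OF abs_triangle_ineq]) simp
qed

lemma sum_gain_bound:
  assumes "i \<le> m"
  shows "\<bar>\<Sum>a<i. gain a v\<bar> \<le> m * (4 * B)"
proof -
  have "\<bar>\<Sum>a<i. gain a v\<bar> \<le> (\<Sum>a<i. 4 * B)"
    using assms gain_bound by (intro order_trans[OF sum_abs] sum_mono) auto
  also have "\<dots> \<le> m * (4 * B)"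
    using assms B0 by (simp add: mult_right_mono)
  finally show ?thesis .
qed

lemma cap_bound:
  assumes "a < m"
  shows "\<bar>cap a\<bar> \<le> 4 * B"
proof -
  note le = cm(5-8)[OF assms]
  have "\<bar>cap a\<bar> \<le> \<bar>c a * m11 a\<bar> + \<bar>c a * m22 a\<bar> + \<bar>c a * m12 a\<bar> + \<bar>c a * m21 a\<bar>"
    unfolding cap_def
    by (intro order_trans[OF abs_triangle_ineq4] order_trans[OF abs_triangle_ineq] add_right_mono order_refl)
  also have "\<dots> \<le> B + B + B + B"
    by (intro add_mono le)
  finally show ?thesis by simp
qed

lemma cap_L: "a < m \<Longrightarrow> cap a \<in> L"
  unfolding cap_def by (intro L_diff L_add cm) auto

text \<open>This is where the condition on the matrices enters.\<close>

lemma cap_nonneg: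
  assumes "a < m"
  shows "0 \<le> cap a"
proof -
  have "cap a = c a * (m11 a + m22 a - (m12 a + m21 a))"
    unfolding cap_def by (simp add: algebra_simps)
  then show ?thesis using supermodular[OF assms] by simp
qed

lemma sum_cap_bound: "(\<Sum>a<m. cap a) \<le> m * (4 * B)"
proof -
  have "(\<Sum>a<m. cap a) \<le> (\<Sum>a<m. 4 * B)"
    by (rule sum_mono, rule abs_le_D1, rule cap_bound) simp
  then show ?thesis by simp
qed

lemma worth_bound: "\<bar>worth {v}\<bar> \<le> m * (8 * B)"
proof -
  let ?X = "\<Sum>a<m. if src a \<in> {v} \<and> dst a \<notin> {v} then cap a else 0"
  have "?X \<le> (\<Sum>a<m. cap a)"
    using cap_nonneg by (intro sum_mono) auto
  moreover have "0 \<le> ?X"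
    using cap_nonneg by (intro sum_nonneg) auto
  ultimately show ?thesis
    using sum_gain_bound[OF order_refl, of v] sum_cap_bound unfolding worth_def by simp
qed

sublocale net: ram_network n m src dst cap worth L kn kr C "12 * (m + 1) * B"
proof
  show "(\<Sum>a<m. cap a) \<le> 12 * (m + 1) * B"
  proof -
    have "12 * (m + 1) * B = 12 * (real m * B) + 12 * B" by (simp add: algebra_simps)
    moreover have "0 \<le> real m * B" using B0 by simp
    ultimately show ?thesis using sum_cap_bound B0 by linarith
  qed
  show "\<bar>worth {v}\<bar> + (\<Sum>a<m. cap a) \<le> 12 * (m + 1) * B" for v
    using worth_bound[of v] sum_cap_bound B0 by (simp add: algebra_simps)
  show "x \<in> L \<Longrightarrow> \<bar>x\<bar> \<le> 12 * (m + 1) * B \<Longrightarrow> kr x \<le> C" for x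
    by (rule kr)
qed (fact arc cap_nonneg L0 L_add L_diff kn C)+

definition loaded :: "store \<Rightarrow> bool" where
  "loaded s \<longleftrightarrow> net.input s \<and>
     (\<forall>a<m. reals s ''c'' a = c a \<and> reals s ''m11'' a = m11 a \<and> reals s ''m12'' a = m12 a \<and>
        reals s ''m21'' a = m21 a \<and> reals s ''m22'' a = m22 a) \<and>
     (\<forall>x\<in>{''e'', ''r'', ''rr''}. reals s x = (\<lambda>_. 0)) \<and>
     (\<forall>x\<in>{''d'', ''mark'', ''X''}. nats s x = (\<lambda>_. 0))"

lemma runs_Init:
  assumes s: "loaded s"
  shows "runs kn kr Init ((m + 1) * (120 * C)) (\<lambda>s'. same_off {''a''} s s' \<and>
    reals s' ''r'' = (\<lambda>a. if a < m then cap a else 0) \<and>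
    reals s' ''rr'' = (\<lambda>_. 0) \<and> reals s' ''e'' = (\<lambda>v. \<Sum>a<m. gain a v)) s"
proof -
  let ?P = "\<lambda>i s'. reals s' ''r'' = (\<lambda>a. if a < i then cap a else 0) \<and>
    reals s' ''e'' = (\<lambda>v. \<Sum>a<i. gain a v) \<and> (\<forall>x. x \<notin> {''r'', ''e''} \<longrightarrow> reals s' x = reals s x)"
  let ?w = "\<lambda>x. RMul (RCell ''c'' (NVar ''a'')) (RCell x (NVar ''a''))"
  let ?u = "NCell ''tail'' (NVar ''a'')" and ?v = "NCell ''head'' (NVar ''a'')"
  let ?p1 = "RAssign ''r'' (NVar ''a'')
      (RSub (RSub (RAdd (?w ''m11'') (?w ''m22'')) (?w ''m12'')) (?w ''m21''))"
  let ?p2 = "RAssign ''e'' ?u (RAdd (RCell ''e'' ?u) (RSub (?w ''m11'') (?w ''m21'')))"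
  let ?p3 = "RAssign ''e'' ?v (RAdd (RCell ''e'' ?v) (RSub (?w ''m21'') (?w ''m22'')))"
  let ?p = "Seq ?p1 (Seq ?p2 ?p3)"
  have inp: "net.input s" using s unfolding loaded_def by blast
  have "runs kn kr (For ''a'' (NVar ''m'') ?p) ((m + 1) * (100 * C + 20 * C))
    (\<lambda>s'. same_off {''a''} s s' \<and> ?P m s') s"
  proof (rule net.runs_For_frame[where P = ?P and Y' = "{}"])
    fix i s' assume i: "i < m" and same: "same_off {''a''} s s'" and a: "nats s' ''a'' 0 = i" and P: "?P i s'"
    have tl: "nats s' ''tail'' i = src i" and hd: "nats s' ''head'' i = dst i"
      using net.input_same_off[OF inp same] i by (simp_all add: net.input_def)
    have dat: "reals s' ''c'' i = c i" "reals s' ''m11'' i = m11 i" "reals s' ''m12'' i = m12 i"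
        "reals s' ''m21'' i = m21 i" "reals s' ''m22'' i = m22 i"
      using P s i by (simp_all add: loaded_def)
    have r: "reals s' ''r'' = (\<lambda>a. if a < i then cap a else 0)"
      and e': "reals s' ''e'' = (\<lambda>v. \<Sum>a<i. gain a v)"
      and rest: "\<And>x. x \<notin> {''r'', ''e''} \<Longrightarrow> reals s' x = reals s x"
      using P by blast+
    note ar = arc[OF i]
    define E where "E = (\<lambda>v. \<Sum>a<i. gain a v)"
    have e: "reals s' ''e'' = E" unfolding e' E_def ..
    have mB: "0 \<le> m * B" using B0 by simp
    then have B': "12 * (m * B) + 12 * B \<le> 12 * (m + 1) * B"
      by (simp add: algebra_simps)
    \<comment> \<open>All intermediate values fit this bound: a partial sum of gains takes
      \<open>4 * (m * B)\<close>, and the data of arc \<open>i\<close> contribute at most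
      \<open>4 * B\<close>.\<close>
    have kr': "kr x \<le> C" if "x \<in> L" "\<bar>x\<bar> \<le> 4 * (m * B) + 4 * B" for x
      using that B' mB B0 by (intro kr) auto
    have kns: "kn i \<le> C" "kn (src i) \<le> C" "kn (dst i) \<le> C" "kn 0 \<le> C"
      using i ar by (auto intro!: kn)
    have k0: "kr x \<le> C" if "x \<in> {c i, m11 i, m12 i, m21 i, m22 i,
       c i * m11 i, c i * m12 i, c i * m21 i, c i * m22 i}" for x
    proof (rule kr')
      show "x \<in> L" using data[OF i that] by blast
      show "\<bar>x\<bar> \<le> 4 * (m * B) + 4 * B" using data[OF i that] mB B0 by linarith
    qed
    have k1: "kr (c i) \<le> C" "kr (m11 i) \<le> C" "kr (m12 i) \<le> C" "kr (m21 i) \<le> C" "kr (m22 i) \<le> C"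
      "kr (c i * m11 i) \<le> C" "kr (c i * m12 i) \<le> C" "kr (c i * m21 i) \<le> C" "kr (c i * m22 i) \<le> C"
      by (rule k0, simp)+
    note b = cm[OF i] note b' = b(5-8)[unfolded abs_le_iff]
    have k2: "kr (c i * m11 i + c i * m22 i) \<le> C"
      "kr (c i * m11 i + c i * m22 i - c i * m12 i) \<le> C"
      "kr (c i * m11 i + c i * m22 i - c i * m12 i - c i * m21 i) \<le> C"
      "kr (c i * m11 i - c i * m21 i) \<le> C" "kr (c i * m21 i - c i * m22 i) \<le> C"
      by (rule kr'; (intro L_add L_diff b(1-4) | (rule abs_leI; use b' mB B0 in linarith)))+
    have k3: "kr (E v) \<le> C" for v
      using sum_gain_L[of i v] sum_gain_bound[of i v] i mB B0 unfolding E_def by (intro kr') simp_all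
    have k4: "kr (E v + x) \<le> C"
      if x: "x = c i * m11 i - c i * m21 i \<or> x = c i * m21 i - c i * m22 i" for v x
    proof (rule kr')
      have "E v \<in> L" unfolding E_def using i by (intro sum_gain_L) simp
      moreover have "x \<in> L" using x by (elim disjE) (simp_all only: L_diff b(1-4))
      ultimately show "E v + x \<in> L" by (rule L_add)
      have "\<bar>E v\<bar> \<le> 4 * (m * B)"
        unfolding E_def using sum_gain_bound[of i v] i by simp
      moreover have "\<bar>x\<bar> \<le> 2 * B" using x b(5-8) by (elim disjE) linarith+
      ultimately show "\<bar>E v + x\<bar> \<le> 4 * (m * B) + 4 * B" using B0 by linarith
    qed
    have k5: "kr (E (src i) + (c i * m11 i - c i * m21 i)) \<le> C"
      "kr (E (dst i) + (c i * m21 i - c i * m22 i)) \<le> C"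
      by (rule k4, simp)+
    show "runs kn kr ?p (100 * C) (\<lambda>s''. same_off {} s' s'' \<and> ?P (Suc i) (nwrite ''a'' 0 (Suc i) s'')) s'"
    proof (rule runs_straight)
      let ?s1 = "rwrite ''r'' i (cap i) s'"
      let ?s2 = "rwrite ''e'' (src i) (E (src i) + (c i * m11 i - c i * m21 i)) ?s1"
      let ?s3 = "rwrite ''e'' (dst i) (E (dst i) + (c i * m21 i - c i * m22 i)) ?s2"
      have s1: "effect ?p1 s' = ?s1"
        by (simp add: a dat cap_def)
      have s2: "effect ?p2 ?s1 = ?s2"
        by (simp add: a tl dat e)
      \<comment> \<open>Since \<open>src i \<noteq> dst i\<close>, the preceding assignment has not
        changed the cell at \<open>dst i\<close>.\<close>
      have s3: "effect ?p3 ?s2 = ?s3"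
        using ar by (simp add: a hd dat e)
      have "charge kn kr ?p1 s' \<le> 40 * C"
        using kns(1,4) k1 k2(1-3) C by (simp add: a dat)
      moreover have "charge kn kr ?p2 ?s1 \<le> 30 * C"
        by (rule charge_gain[where i = i and u = "src i" and E = "E (src i)"
              and c = "c i" and p = "m11 i" and q = "m21 i"])
          (use C in \<open>simp_all add: a tl dat e kns k1 k2 k3 k5\<close>)
      moreover have "charge kn kr ?p3 ?s2 \<le> 30 * C"
        by (rule charge_gain[where i = i and u = "dst i" and E = "E (dst i)"
              and c = "c i" and p = "m21 i" and q = "m22 i"])
          (use C ar in \<open>simp_all add: a hd dat e kns k1 k2 k3 k5\<close>)
      ultimately show "charge kn kr ?p s' \<le> 100 * C"
        unfolding charge.simps(3) s1 s2 by linarith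
      have eff: "effect ?p s' = ?s3"
        unfolding effect.simps(3) s1 s2 s3 ..
      have "reals (effect ?p s') ''e'' = (\<lambda>v. E v + gain i v)"
        using ar unfolding eff by (auto simp: e fun_eq_iff gain_def)
      then have "reals (effect ?p s') ''e'' = (\<lambda>v. \<Sum>a<Suc i. gain a v)"
        by (simp only: E_def sum.lessThan_Suc)
      moreover have "reals (effect ?p s') ''r'' = (\<lambda>a. if a < Suc i then cap a else 0)"
        unfolding eff by (auto simp: r fun_eq_iff)
      moreover have "same_off {} s' (effect ?p s')"
        unfolding eff by (simp add: same_off_def)
      moreover have "reals (effect ?p s') x = reals s x" if "x \<notin> {''r'', ''e''}" for x
        unfolding eff using rest[OF that] that by simp
      ultimately show "same_off {} s' (effect ?p s') \<and> ?P (Suc i) (nwrite ''a'' 0 (Suc i) (effect ?p s'))"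
        by (simp only: nats_nwrite reals_nwrite) blast
    qed simp
  qed (use inp s in \<open>simp_all add: loaded_def\<close>)
  then show ?thesis
    unfolding Init_def Let_def
    by (rule runs_mono) (use s in \<open>simp_all add: loaded_def\<close>)
qed

text \<open>Exchanging the sums over vertices and arcs leaves one term per arc, ready for comparison
  with \<open>arc_weight\<close>.\<close>

lemma worth_eq:
  assumes "S \<subseteq> {..<n}"
  shows "worth S = (\<Sum>a<m. (if src a \<in> S then c a * m11 a - c a * m21 a else 0) +
     (if dst a \<in> S then c a * m21 a - c a * m22 a else 0) - (if src a \<in> S \<and> dst a \<notin> S then cap a else 0))"
proof -
  have "finite S" using assms finite_subset by blast
  have "(\<Sum>v\<in>S. \<Sum>a<m. gain a v) = (\<Sum>a<m. \<Sum>v\<in>S. gain a v)"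
    by (rule sum.swap)
  also have "\<dots> = (\<Sum>a<m. (if src a \<in> S then c a * m11 a - c a * m21 a else 0) +
     (if dst a \<in> S then c a * m21 a - c a * m22 a else 0))"
    unfolding gain_def using \<open>finite S\<close> by (simp add: sum.distrib)
  finally show ?thesis
    unfolding worth_def by (simp add: sum_subtractf)
qed

lemma runs_Solver:
  assumes s: "loaded s"
  shows "runs kn kr Solver (700 * C * (n + m + 1) ^ 4)
    (\<lambda>s'. \<exists>S\<subseteq>{..<n}. nats s' ''X'' = (\<lambda>v. if v \<in> S then 1 else 0) \<and> (\<forall>T\<subseteq>{..<n}. worth T \<le> worth S)) s"
proof -
  have "runs kn kr Solver ((m + 1) * (120 * C) + net.flow_time)
    (\<lambda>s'. \<exists>S\<subseteq>{..<n}. nats s' ''X'' = (\<lambda>v. if v \<in> S then 1 else 0) \<and> (\<forall>T\<subseteq>{..<n}. worth T \<le> worth S)) s"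
    unfolding Solver_def
  proof (rule runs_Seq[OF runs_Init[OF s]])
    fix s1 assume s1: "same_off {''a''} s s1 \<and>
      reals s1 ''r'' = (\<lambda>a. if a < m then cap a else 0) \<and>
      reals s1 ''rr'' = (\<lambda>_. 0) \<and> reals s1 ''e'' = (\<lambda>v. \<Sum>a<m. gain a v)"
    note same = conjunct1[OF s1]
    have inp: "net.input s1"
      using net.input_same_off[OF _ same] s by (simp add: loaded_def)
    have z: "nats s1 ''d'' = (\<lambda>_. 0)" "nats s1 ''mark'' = (\<lambda>_. 0)" "nats s1 ''X'' = (\<lambda>_. 0)"
      using same_off_nats[OF same] s by (simp_all add: loaded_def)
    \<comment> \<open>With all labels 0 the labelling is valid and \<open>e\<close> may have any
      sign.\<close>
    have "net.flow s1"
      unfolding net.preflow_def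
    proof (intro conjI allI impI)
      fix S :: "nat set"
      have "(\<Sum>a<m. (if src a \<in> S \<and> dst a \<notin> S then reals s1 ''r'' a else 0) +
              (if dst a \<in> S \<and> src a \<notin> S then reals s1 ''rr'' a else 0)) =
            (\<Sum>a<m. if src a \<in> S \<and> dst a \<notin> S then cap a else 0)"
        using s1 by (intro sum.cong) auto
      then show "cut_value m src dst (reals s1 ''e'') (reals s1 ''r'') (reals s1 ''rr'') S = worth S"
        using s1 unfolding cut_value_def worth_def by simp
    qed (use s1 z cap_nonneg cap_L L0 sum_gain_L[OF order_refl] in auto)
    then show "runs kn kr (Seq Rounds (Seq Mark (Seq Gap Select))) net.flow_time
      (\<lambda>s'. \<exists>S\<subseteq>{..<n}. nats s' ''X'' = (\<lambda>v. if v \<in> S then 1 else 0) \<and> (\<forall>T\<subseteq>{..<n}. worth T \<le> worth S)) s1"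
      using inp z(2,3) by (intro net.runs_flow)
  qed
  moreover have "(m + 1) * (120 * C) + net.flow_time \<le> 700 * C * (n + m + 1) ^ 4"
  proof -
    have "(m + 1) * (120 * C) \<le> (n + m + 1) ^ 4 * (120 * C)"
      using self_le_power[of "n + m + 1" 4] by (intro mult_right_mono) auto
    then show ?thesis using net.flow_time_le by (simp add: algebra_simps)
  qed
  ultimately show ?thesis
    by (blast intro: runs_mono)
qed

end

section \<open>Bit lengths\<close>

text \<open>The inverse inside \<open>real_bits\<close>, meaningful for rational arguments
  only.\<close>

definition rat_of :: "real \<Rightarrow> rat" where
  "rat_of x = the_inv of_rat x"

definition den :: "real \<Rightarrow> nat" where
  "den x = nat (snd (quotient_of (rat_of x)))"

definition num :: "real \<Rightarrow> int" where
  "num x = fst (quotient_of (rat_of x))"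

lemma of_rat_rat_of:
  assumes "x \<in> \<rat>"
  shows "of_rat (rat_of x) = x"
proof -
  have "inj (of_rat :: rat \<Rightarrow> real)" by (simp add: inj_def)
  moreover obtain r where "x = of_rat r" using assms by (auto elim: Rats_cases)
  ultimately show ?thesis unfolding rat_of_def by (simp add: the_inv_f_f)
qed

lemma den_pos: "0 < den x"
  unfolding den_def using quotient_of_denom_pos'[of "rat_of x"] by simp

lemma num_den:
  assumes "x \<in> \<rat>"
  shows "x = num x / den x"
proof -
  have "rat_of x = of_int (num x) / of_int (snd (quotient_of (rat_of x)))"
    unfolding num_def by (rule quotient_of_div) simp
  moreover have "snd (quotient_of (rat_of x)) = int (den x)"
    unfolding den_def using quotient_of_denom_pos'[of "rat_of x"] by simp
  ultimately have "of_rat (rat_of x) = of_int (num x) / real (den x)"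
    by (metis of_int_of_nat_eq of_rat_divide of_rat_of_int_eq)
  then show ?thesis using of_rat_rat_of[OF assms] by simp
qed

lemma real_bits_eq: "real_bits x = floorlog 2 (nat \<bar>num x\<bar>) + floorlog 2 (den x) + 1"
  unfolding real_bits_def rat_bits_def num_def den_def rat_of_def by simp

lemma den_le: "den x \<le> 2 ^ real_bits x"
proof -
  have "den x < 2 ^ floorlog 2 (den x)"
    by (rule floorlog_leD) simp_all
  also have "\<dots> \<le> 2 ^ real_bits x"
    unfolding real_bits_eq by (rule power_increasing) simp_all
  finally show ?thesis by simp
qed

lemma abs_le_bits:
  assumes "x \<in> \<rat>"
  shows "\<bar>x\<bar> \<le> 2 ^ real_bits x"
proof -
  have "nat \<bar>num x\<bar> < 2 ^ floorlog 2 (nat \<bar>num x\<bar>)"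
    by (rule floorlog_leD) simp_all
  also have "\<dots> \<le> 2 ^ real_bits x"
    unfolding real_bits_eq by (rule power_increasing) simp_all
  finally have "real (nat \<bar>num x\<bar>) \<le> real (2 ^ real_bits x)"
    using of_nat_le_iff less_imp_le by blast
  then have "\<bar>real_of_int (num x)\<bar> \<le> 2 ^ real_bits x" by simp
  moreover have "\<bar>x\<bar> \<le> \<bar>real_of_int (num x)\<bar>"
  proof -
    have "\<bar>x\<bar> = \<bar>real_of_int (num x)\<bar> / den x"
      by (subst num_den[OF assms]) simp
    also have "\<dots> \<le> \<bar>real_of_int (num x)\<bar> / 1"
      using den_pos[of x] by (intro divide_left_mono) auto
    finally show ?thesis by simp
  qed
  ultimately show ?thesis by linarith
qed

section \<open>Rationals with a common denominator\<close>

definition grid :: "nat \<Rightarrow> real set" where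
  "grid R = range (\<lambda>z::int. of_int z / of_nat R)"

lemma gridI: "x = of_int z / of_nat R \<Longrightarrow> x \<in> grid R"
  unfolding grid_def by blast

lemma grid_0: "0 \<in> grid R"
  by (rule gridI[of _ 0]) simp

lemma grid_add: "x \<in> grid R \<Longrightarrow> y \<in> grid R \<Longrightarrow> x + y \<in> grid R"
  unfolding grid_def by (auto simp: add_divide_distrib[symmetric] intro: range_eqI[of _ _ "_ + _"])

lemma grid_diff: "x \<in> grid R \<Longrightarrow> y \<in> grid R \<Longrightarrow> x - y \<in> grid R"
  unfolding grid_def by (auto simp: diff_divide_distrib[symmetric] intro: range_eqI[of _ _ "_ - _"])

lemma grid_mult:
  assumes "x \<in> grid R" "y \<in> grid R"
  shows "x * y \<in> grid (R ^ 2)"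
proof -
  obtain z w :: int where "x = of_int z / of_nat R" "y = of_int w / of_nat R"
    using assms unfolding grid_def by blast
  then show ?thesis
    by (intro gridI[of _ "z * w"]) (simp add: power2_eq_square)
qed

lemma grid_dvd:
  assumes "x \<in> grid R" "R dvd R'" "0 < R'"
  shows "x \<in> grid R'"
proof -
  obtain z :: int where x: "x = of_int z / of_nat R"
    using assms unfolding grid_def by blast
  obtain k where k: "R' = R * k" using assms(2) by blast
  then show ?thesis
    using assms(3) x by (intro gridI[of _ "z * int k"]) simp
qed

lemma grid_den: "x \<in> \<rat> \<Longrightarrow> x \<in> grid (den x)"
  by (rule gridI[OF num_den])

text \<open>In lowest terms the denominator divides \<open>R\<close>, so it is at most
  \<open>2 ^ J\<close>; the numerator is \<open>x\<close> times the denominator, hence at most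
  \<open>2 ^ (K + J)\<close> in absolute value. So the length does not depend on how
  \<open>x\<close> was computed.\<close>

lemma real_bits_grid:
  assumes "x \<in> grid R" "0 < R" "R \<le> 2 ^ J" "\<bar>x\<bar> \<le> 2 ^ K"
  shows "real_bits x \<le> 2 * J + K + 3"
proof -
  obtain z :: int where z: "x = of_int z / of_nat R"
    using assms(1) unfolding grid_def by blast
  then have rat: "x \<in> \<rat>" by simp
  have cop: "coprime (num x) (int (den x))"
  proof -
    have "snd (quotient_of (rat_of x)) = int (den x)"
      unfolding den_def using quotient_of_denom_pos'[of "rat_of x"] by simp
    then show ?thesis
      using quotient_of_coprime[of "rat_of x" "num x" "int (den x)"] unfolding num_def
      by (metis prod.collapse)
  qed
  have "real_of_int (num x) * real R = real_of_int z * real (den x)"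
  proof -
    have "real_of_int (num x) / real (den x) = real_of_int z / real R"
      using num_den[OF rat] z by simp
    then show ?thesis using den_pos[of x] assms(2) by (simp add: frac_eq_eq)
  qed
  then have "real_of_int (num x * int R) = real_of_int (z * int (den x))" by simp
  then have "num x * int R = z * int (den x)" by (simp only: of_int_eq_iff)
  then have "int (den x) dvd num x * int R" by simp
  then have "int (den x) dvd int R"
    using cop by (metis coprime_commute coprime_dvd_mult_right_iff)
  then have "den x dvd R" by simp
  then have dJ: "den x \<le> 2 ^ J"
    using assms(2,3) dvd_imp_le le_trans by blast
  have "real_of_int (num x) = x * den x"
    using num_den[OF rat] den_pos[of x] by (simp add: field_simps)
  then have "\<bar>real_of_int (num x)\<bar> = \<bar>x\<bar> * den x"
    by (simp add: abs_mult)
  also have "\<dots> \<le> 2 ^ K * 2 ^ J"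
    using assms(4) dJ by (intro mult_mono) (simp_all add: numeral_power_le_of_nat_cancel_iff
      of_nat_le_numeral_power_cancel_iff)
  finally have "real (nat \<bar>num x\<bar>) \<le> real (2 ^ (K + J))"
    by (simp add: power_add)
  then have nK: "nat \<bar>num x\<bar> \<le> 2 ^ (K + J)"
    using of_nat_le_iff by blast
  have "floorlog 2 (nat \<bar>num x\<bar>) \<le> Suc (K + J)"
    by (rule floorlog_leI, rule le_less_trans[OF nK]) simp_all
  moreover have "floorlog 2 (den x) \<le> Suc J"
    by (rule floorlog_leI, rule le_less_trans[OF dJ]) simp_all
  ultimately show ?thesis
    unfolding real_bits_eq by simp
qed

text \<open>A linear bound suffices, as the naturals that occur are linear in \<open>n\<close> and
  \<open>m\<close>.\<close>

lemma nat_bits_le: "nat_bits k \<le> k + 1"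
  unfolding nat_bits_def by (simp add: floorlog_leI)

section \<open>Presentations of instances\<close>

lemma position_nth:
  assumes "v \<in> set vs"
  shows "position vs v < length vs" "vs ! position vs v = v"
  using assms unfolding position_def by (induction vs) auto

lemma position_inj:
  "v \<in> set vs \<Longrightarrow> w \<in> set vs \<Longrightarrow> position vs v = position vs w \<Longrightarrow> v = w"
  by (metis position_nth(2))

lemma array_nth: "i < length xs \<Longrightarrow> array xs i = xs ! i"
  by (simp add: array_def)

lemma array_Nil: "array [] = (\<lambda>_. 0)"
  by (simp add: array_def fun_eq_iff)

lemma sum_nth: "distinct xs \<Longrightarrow> (\<Sum>x\<in>set xs. g x) = (\<Sum>i<length xs. g (xs ! i))"
  by (rule sum.reindex_bij_betw[symmetric, OF bij_betw_nth]) simp_all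

lemma exists_abs_bound:
  fixes X :: "real set"
  assumes "finite X"
  shows "\<exists>B\<ge>0. \<forall>x\<in>X. \<bar>x\<bar> \<le> B"
  using assms by (intro exI[of _ "\<Sum>x\<in>X. \<bar>x\<bar>"]) (auto intro: sum_nonneg member_le_sum[where f = abs])

section \<open>One presentation of one instance\<close>

locale presentation =
  fixes D :: "nat pair_pre_digraph" and c :: "nat \<times> nat \<Rightarrow> real" and f :: "nat \<times> nat \<Rightarrow> mat2"
    and vs :: "nat list" and xs :: "(nat \<times> nat) list"
  assumes D: "pair_digraph D" and present: "presents vs xs D"
    and c_nonneg: "a \<in> parcs D \<Longrightarrow> 0 \<le> c a"
    and f_super: "a \<in> parcs D \<Longrightarrow> f a $ 1 $ 2 + f a $ 2 $ 1 \<le> f a $ 1 $ 1 + f a $ 2 $ 2"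
begin

abbreviation "n \<equiv> length vs"
abbreviation "m \<equiv> length xs"
abbreviation "src i \<equiv> position vs (fst (xs ! i))"
abbreviation "dst i \<equiv> position vs (snd (xs ! i))"
abbreviation "ci i \<equiv> c (xs ! i)"
abbreviation "f11 i \<equiv> f (xs ! i) $ 1 $ 1"
abbreviation "f12 i \<equiv> f (xs ! i) $ 1 $ 2"
abbreviation "f21 i \<equiv> f (xs ! i) $ 2 $ 1"
abbreviation "f22 i \<equiv> f (xs ! i) $ 2 $ 2"

lemma lists: "distinct vs" "set vs = pverts D" "distinct xs" "set xs = parcs D"
  using present unfolding presents_def by auto

lemma xs_arc: "i < m \<Longrightarrow> xs ! i \<in> parcs D"
  using lists(4) nth_mem by blast

lemma ends:
  assumes "a \<in> parcs D"
  shows "fst a \<in> set vs" "snd a \<in> set vs" "fst a \<noteq> snd a"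
proof -
  interpret pair_digraph D by (rule D)
  show "fst a \<in> set vs" "snd a \<in> set vs" "fst a \<noteq> snd a"
    using assms lists(2) arc_fst_in_verts arc_snd_in_verts pair_no_loops by auto
qed

lemma size_bound: "(\<And>x. 1 \<le> kr x) \<Longrightarrow> n + m \<le> input_size kr D c f"
proof -
  assume kr: "\<And>x. 1 \<le> kr x"
  have "m = (\<Sum>a\<in>parcs D. 1)"
    using lists(3,4) distinct_card by fastforce
  also have "\<dots> \<le> (\<Sum>a\<in>parcs D. kr (c a) + (\<Sum>i\<in>UNIV. \<Sum>j\<in>UNIV. kr (f a $ i $ j)))"
    using kr by (intro sum_mono) (simp add: trans_le_add1)
  finally show ?thesis
    unfolding input_size_def using lists(1,2) distinct_card by fastforce
qed

lemma solves:
  assumes "ram_instance n m src dst ci f11 f12 f21 f22 L kn kr C B"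
  shows "\<exists>t s. exec kn kr Solver (input_store vs xs c f) t s \<and>
    t \<le> 700 * C * (n + m + 1) ^ 4 \<and> optimal_partition D c f (output_partition vs s)"
proof -
  interpret ram_instance n m src dst ci f11 f12 f21 f22 L kn kr C B by (rule assms)
  have "loaded (input_store vs xs c f)"
    unfolding loaded_def net.input_def input_store_def by (simp add: array_nth array_Nil)
  from runs_Solver[OF this] obtain t s S where
    run: "exec kn kr Solver (input_store vs xs c f) t s" "t \<le> 700 * C * (n + m + 1) ^ 4"
    and S: "S \<subseteq> {..<n}" "nats s ''X'' = (\<lambda>v. if v \<in> S then 1 else 0)"
      "\<And>T. T \<subseteq> {..<n} \<Longrightarrow> worth T \<le> worth S"
    unfolding runs_def by blast
  \<comment> \<open>The constant is the weight for an empty first part. Per arc, and up to the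
    factor \<open>c\<close>: both ends in the first part give
    \<open>m22 + (m11 - m21) + (m21 - m22) = m11\<close>, the tail alone
    \<open>m22 + (m11 - m21) - (m11 + m22 - m12 - m21) = m12\<close>, the head alone
    \<open>m22 + (m21 - m22) = m21\<close>.\<close>
  have weight: "partition_weight D c f P = (\<Sum>i<m. ci i * f22 i) + worth {i. i < n \<and> vs ! i \<in> fst P}"
    if P: "bipartition (pverts D) P" for P
  proof -
    let ?T = "{i. i < n \<and> vs ! i \<in> fst P}"
    have mem: "position vs v \<in> ?T \<longleftrightarrow> v \<in> fst P" "v \<in> fst P \<longleftrightarrow> v \<notin> snd P" if "v \<in> set vs" for v
      using that position_nth[OF that] P lists(2) unfolding bipartition_def by auto
    have "partition_weight D c f P = (\<Sum>i<m. arc_weight c f P (xs ! i))"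
      unfolding partition_weight_def using sum_nth[OF lists(3)] lists(4) by simp
    also have "\<dots> = (\<Sum>i<m. ci i * f22 i + ((if src i \<in> ?T then ci i * f11 i - ci i * f21 i else 0) +
     (if dst i \<in> ?T then ci i * f21 i - ci i * f22 i else 0) - (if src i \<in> ?T \<and> dst i \<notin> ?T then cap i else 0)))"
    proof (rule sum.cong)
      fix i assume "i \<in> {..<m}"
      then have "xs ! i \<in> parcs D" using xs_arc by blast
      note e = ends[OF this]
      show "arc_weight c f P (xs ! i) = ci i * f22 i + ((if src i \<in> ?T then ci i * f11 i - ci i * f21 i else 0) +
        (if dst i \<in> ?T then ci i * f21 i - ci i * f22 i else 0) - (if src i \<in> ?T \<and> dst i \<notin> ?T then cap i else 0))"
        unfolding arc_weight_def Let_def mem(1)[OF e(1)] mem(1)[OF e(2)]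
        using mem(2)[OF e(1)] mem(2)[OF e(2)] by (simp add: cap_def)
    qed simp
    also have "\<dots> = (\<Sum>i<m. ci i * f22 i) + worth ?T"
      by (subst worth_eq) (auto simp: sum.distrib)
    finally show ?thesis .
  qed
  let ?P = "output_partition vs s"
  have bi: "bipartition (pverts D) ?P"
    unfolding bipartition_def output_partition_def lists(2)[symmetric]
    using lists(1) by (auto simp: in_set_conv_nth nth_eq_iff_index_eq) blast
  have "{i. i < n \<and> vs ! i \<in> fst ?P} = S"
    unfolding output_partition_def using lists(1) S(1,2) by (auto simp: nth_eq_iff_index_eq)
  then have "partition_weight D c f R \<le> partition_weight D c f ?P" if "bipartition (pverts D) R" for R
    using weight[OF bi] weight[OF that] S(3)[of "{i. i < n \<and> vs ! i \<in> fst R}"] by auto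
  then have "optimal_partition D c f ?P"
    unfolding optimal_partition_def using bi by blast
  with run show ?thesis by blast
qed

lemma instance_axioms:
  assumes "i < m"
  shows "src i < n \<and> dst i < n \<and> src i \<noteq> dst i" and "0 \<le> ci i \<and> f12 i + f21 i \<le> f11 i + f22 i"
  using ends[OF xs_arc[OF assms]] position_nth position_inj c_nonneg[OF xs_arc[OF assms]]
    f_super[OF xs_arc[OF assms]] by (metis, simp)

section \<open>The two cost measures\<close>

definition entries :: "nat \<Rightarrow> real set" where
  "entries i = {ci i, f11 i, f12 i, f21 i, f22 i, ci i * f11 i, ci i * f12 i, ci i * f21 i, ci i * f22 i}"

text \<open>For unit charges \<open>L\<close> is everything, \<open>C\<close> is 1, and any bound on
  the finitely many entries serves as \<open>B\<close>.\<close>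

lemma solves_unit:
  "\<exists>t s. exec (\<lambda>_. 1) (\<lambda>_. 1) Solver (input_store vs xs c f) t s \<and>
    t \<le> 700 * (input_size (\<lambda>_. 1) D c f + 1) ^ 4 \<and> optimal_partition D c f (output_partition vs s)"
proof -
  obtain B where B: "0 \<le> B" "\<And>x. x \<in> (\<Union>i<m. entries i) \<Longrightarrow> \<bar>x\<bar> \<le> B"
    using exists_abs_bound[of "\<Union>i<m. entries i"] by (auto simp: entries_def)
  have "ram_instance n m src dst ci f11 f12 f21 f22 UNIV (\<lambda>_. 1) (\<lambda>_. 1) 1 B"
  proof
    show "x \<in> UNIV \<and> \<bar>x\<bar> \<le> B" if "i < m"
      "x \<in> {ci i, f11 i, f12 i, f21 i, f22 i, ci i * f11 i, ci i * f12 i, ci i * f21 i, ci i * f22 i}" for i x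
      using that B(2)[of x] unfolding entries_def by blast
  qed (use instance_axioms B(1) in auto)
  from solves[OF this] obtain t s where *: "exec (\<lambda>_. 1) (\<lambda>_. 1) Solver (input_store vs xs c f) t s"
    "t \<le> 700 * 1 * (n + m + 1) ^ 4" "optimal_partition D c f (output_partition vs s)" by blast
  have "(n + m + 1) ^ 4 \<le> (input_size (\<lambda>_. 1) D c f + 1) ^ 4"
    using size_bound[of "\<lambda>_. 1"] by (intro power_mono) auto
  with *(2) have "t \<le> 700 * (input_size (\<lambda>_. 1) D c f + 1) ^ 4" by linarith
  with * show ?thesis by blast
qed

lemma input_size_eq:
  "input_size kr D c f =
     n + (\<Sum>i<m. kr (ci i) + kr (f11 i) + kr (f12 i) + kr (f21 i) + kr (f22 i))"
proof -
  have "(\<Sum>a\<in>parcs D. kr (c a) + (\<Sum>i\<in>UNIV. \<Sum>j\<in>UNIV. kr (f a $ i $ j))) =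
    (\<Sum>i<m. kr (ci i) + kr (f11 i) + kr (f12 i) + kr (f21 i) + kr (f22 i))"
    unfolding lists(4)[symmetric] sum_nth[OF lists(3)] by (simp add: sum_2 add_ac)
  moreover have "card (pverts D) = n"
    using lists(1,2) distinct_card by fastforce
  ultimately show ?thesis unfolding input_size_def by simp
qed

text \<open>\<open>real_bits_grid\<close> with \<open>J = 2 * size\<close> and
  \<open>K = 3 * size + 4\<close> gives \<open>7 * size + 7\<close>, whence the charge
  \<open>7 * size + 10\<close>.\<close>

lemma solves_bits:
  assumes rational: "rational_data D c f"
  shows "\<exists>t s. exec nat_bits real_bits Solver (input_store vs xs c f) t s \<and>
    t \<le> 700 * (7 * input_size real_bits D c f + 10) * (input_size real_bits D c f + 1) ^ 4 \<and>
    optimal_partition D c f (output_partition vs s)"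
proof -
  define size where "size = input_size real_bits D c f"
  define bits where "bits = (\<lambda>i. real_bits (ci i) + real_bits (f11 i) + real_bits (f12 i) +
    real_bits (f21 i) + real_bits (f22 i))"
  define dens where "dens = (\<lambda>i. den (ci i) * den (f11 i) * den (f12 i) * den (f21 i) * den (f22 i))"
  define Q where "Q = (\<Prod>i<m. dens i)"
  have size: "size = n + (\<Sum>i<m. bits i)"
    unfolding size_def bits_def by (rule input_size_eq)
  have nm: "n + m \<le> size"
    unfolding size_def by (rule size_bound) (simp add: real_bits_eq)
  have bits_le: "bits i \<le> size" if "i < m" for i
    unfolding size using that member_le_sum[of i "{..<m}" bits] by simp
  have "0 < dens i" for i
    unfolding dens_def by (simp add: den_pos)
  then have Q0: "0 < Q" unfolding Q_def by (simp add: prod_pos)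
  \<comment> \<open>Each denominator is at most 2 to the length of its number; multiplying adds
    these lengths, and their total is part of the input size.\<close>
  have "Q \<le> (\<Prod>i<m. 2 ^ bits i)"
    unfolding Q_def
  proof (intro prod_mono conjI)
    fix i
    show "dens i \<le> 2 ^ bits i"
      unfolding dens_def bits_def power_add by (intro mult_mono den_le) simp_all
  qed simp
  also have "\<dots> = 2 ^ (\<Sum>i<m. bits i)" by (simp add: power_sum)
  also have "\<dots> \<le> 2 ^ size" unfolding size by (intro power_increasing) simp_all
  finally have Q_le: "Q \<le> 2 ^ size" .
  have Q2: "0 < Q ^ 2" "Q ^ 2 \<le> 2 ^ (2 * size)"
    using Q0 power_mono[OF Q_le, of 2] by (simp_all add: power_mult[symmetric] mult.commute)
  have datum: "x \<in> grid Q \<and> \<bar>x\<bar> \<le> 2 ^ size"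
    if i: "i < m" and x: "x \<in> {ci i, f11 i, f12 i, f21 i, f22 i}" for i x
  proof
    have rat: "x \<in> \<rat>"
      using rational xs_arc[OF i] x unfolding rational_data_def by auto
    have "den x dvd dens i"
      using x unfolding dens_def by (elim insertE emptyE) (simp_all add: dvd_mult dvd_mult2)
    moreover have "dens i dvd Q"
      unfolding Q_def using i by (intro dvd_prodI) simp_all
    ultimately have "den x dvd Q" by (rule dvd_trans)
    then show "x \<in> grid Q"
      using grid_dvd[OF grid_den[OF rat]] Q0 by blast
    have "real_bits x \<le> bits i"
      using x unfolding bits_def by auto
    then have "(2::real) ^ real_bits x \<le> 2 ^ size"
      using bits_le[OF i] by (intro power_increasing) simp_all
    with abs_le_bits[OF rat] show "\<bar>x\<bar> \<le> 2 ^ size" by linarith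
  qed
  have single: "x \<in> grid (Q ^ 2) \<and> \<bar>x\<bar> \<le> 2 ^ (2 * size)"
    if "i < m" and "x \<in> {ci i, f11 i, f12 i, f21 i, f22 i}" for i x
  proof
    show "x \<in> grid (Q ^ 2)"
      using grid_dvd[of x Q "Q ^ 2"] datum[OF that] Q2(1) by (simp add: power2_eq_square)
    have "(2::real) ^ size \<le> 2 ^ (2 * size)" by (intro power_increasing) simp_all
    with datum[OF that] show "\<bar>x\<bar> \<le> 2 ^ (2 * size)" by linarith
  qed
  have product: "ci i * y \<in> grid (Q ^ 2) \<and> \<bar>ci i * y\<bar> \<le> 2 ^ (2 * size)"
    if i: "i < m" and y: "y \<in> {f11 i, f12 i, f21 i, f22 i}" for i y
  proof
    have c: "ci i \<in> grid Q \<and> \<bar>ci i\<bar> \<le> 2 ^ size" and y': "y \<in> grid Q \<and> \<bar>y\<bar> \<le> 2 ^ size"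
      using datum[OF i] y by blast+
    then show "ci i * y \<in> grid (Q ^ 2)" using grid_mult by blast
    have "\<bar>ci i * y\<bar> \<le> 2 ^ size * 2 ^ size"
      unfolding abs_mult using c y' by (intro mult_mono) auto
    then show "\<bar>ci i * y\<bar> \<le> 2 ^ (2 * size)" by (simp add: mult_2 power_add)
  qed
  \<comment> \<open>From \<open>12 \<le> 2 ^ 4\<close> and
    \<open>m + 1 \<le> 2 ^ m \<le> 2 ^ size\<close>.\<close>
  have B: "12 * (m + 1) * (2::real) ^ (2 * size) \<le> 2 ^ (3 * size + 4)"
  proof -
    have "real (m + 1) \<le> real (2 ^ m)"
      using Suc_leI[OF less_exp[of m]] by (intro of_nat_mono) simp
    also have "\<dots> \<le> 2 ^ size" using nm by simp
    finally have "real (m + 1) * 2 ^ (2 * size) \<le> 2 ^ size * 2 ^ (2 * size)"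
      by (intro mult_right_mono) simp_all
    also have "\<dots> = 2 ^ (3 * size)" by (simp flip: power_add)
    finally have "16 * (real (m + 1) * 2 ^ (2 * size)) \<le> 16 * 2 ^ (3 * size)" by simp
    moreover have "12 * (real (m + 1) * 2 ^ (2 * size)) \<le> 16 * (real (m + 1) * 2 ^ (2 * size))"
      by (intro mult_right_mono) simp_all
    moreover have "16 * (2::real) ^ (3 * size) = 2 ^ (3 * size + 4)"
      by (simp add: power_add)
    ultimately have "12 * (real (m + 1) * 2 ^ (2 * size)) \<le> 2 ^ (3 * size + 4)" by linarith
    then show ?thesis by (simp add: algebra_simps)
  qed
  have "ram_instance n m src dst ci f11 f12 f21 f22 (grid (Q ^ 2)) nat_bits real_bits
    (7 * size + 10) (2 ^ (2 * size))"
  proof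
    show "x \<in> grid (Q ^ 2) \<and> \<bar>x\<bar> \<le> 2 ^ (2 * size)" if i: "i < m"
      and x: "x \<in> {ci i, f11 i, f12 i, f21 i, f22 i, ci i * f11 i, ci i * f12 i, ci i * f21 i, ci i * f22 i}" for i x
    proof -
      consider "x \<in> {ci i, f11 i, f12 i, f21 i, f22 i}" | y where "y \<in> {f11 i, f12 i, f21 i, f22 i}" "x = ci i * y"
        using x by blast
      then show ?thesis using single[OF i] product[OF i] by cases blast+
    qed
    show "real_bits x \<le> 7 * size + 10"
      if x: "x \<in> grid (Q ^ 2)" "\<bar>x\<bar> \<le> 12 * (m + 1) * (2::real) ^ (2 * size)" for x
      using real_bits_grid[OF x(1) Q2 order_trans[OF x(2) B]] by simp
    show "nat_bits k \<le> 7 * size + 10" if "k \<le> 2 * n + m + 2" for k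
      using nat_bits_le[of k] that nm by linarith
  qed (use instance_axioms in \<open>simp_all add: grid_0 grid_add grid_diff\<close>)
  from solves[OF this] obtain t s where *: "exec nat_bits real_bits Solver (input_store vs xs c f) t s"
    "t \<le> 700 * (7 * size + 10) * (n + m + 1) ^ 4" "optimal_partition D c f (output_partition vs s)"
    by blast
  have "(n + m + 1) ^ 4 \<le> (size + 1) ^ 4"
    using nm by (intro power_mono) auto
  then have "700 * (7 * size + 10) * (n + m + 1) ^ 4 \<le> 700 * (7 * size + 10) * (size + 1) ^ 4"
    by (rule mult_left_mono) simp
  with * show ?thesis unfolding size_def by (blast intro: le_trans)
qed

end

theorem theorem4:
  fixes F :: "(real^2^2) set"
  assumes "\<And>M. M \<in> F \<Longrightarrow> M$1$1 + M$2$2 \<ge> M$1$2 + M$2$1"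
  shows "MWDP_polynomial_time F"
proof -
  let ?q = "[:700:] * [:1, 1:] ^ 4 :: nat poly"
  \<comment> \<open>The linear factor is \<open>700 * (7 * x + 10)\<close>, as in
    \<open>solves_bits\<close>.\<close>
  let ?q' = "[:7000, 4900:] * [:1, 1:] ^ 4 :: nat poly"
  have pres: "presentation D c f vs xs" if "MWDP_instance F D c f" "presents vs xs D" for D c f vs xs
    using that assms unfolding MWDP_instance_def presentation_def by blast
  have "solves_MWDP_within (\<lambda>_. 1) (\<lambda>_. 1) Solver ?q D c f \<and>
      (rational_data D c f \<longrightarrow> solves_MWDP_within nat_bits real_bits Solver ?q' D c f)"
    if inst: "MWDP_instance F D c f" for D c f
    unfolding solves_MWDP_within_def
  proof (intro conjI allI impI)
    fix vs xs assume "presents vs xs D"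
    with presentation.solves_unit[OF pres[OF inst]]
    show "\<exists>t s. exec (\<lambda>_. 1) (\<lambda>_. 1) Solver (input_store vs xs c f) t s \<and>
        t \<le> poly ?q (input_size (\<lambda>_. 1) D c f) \<and> optimal_partition D c f (output_partition vs s)"
      by (simp add: add.commute)
  next
    fix vs xs assume "rational_data D c f" "presents vs xs D"
    with presentation.solves_bits[OF pres[OF inst]]
    show "\<exists>t s. exec nat_bits real_bits Solver (input_store vs xs c f) t s \<and>
        t \<le> poly ?q' (input_size real_bits D c f) \<and> optimal_partition D c f (output_partition vs s)"
      by (simp add: algebra_simps)
  qed
  then show ?thesis
    unfolding MWDP_polynomial_time_def by blast
qed

end
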